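(* Consider the controllable LTI system $x_{t+1}=Ax_t+Bu_t$, $y_t=Cx_t+Du_t$ with $x_t\in\mathbb{R}^{n_x}$, $u_t\in\mathbb{R}^{n_u}$, $y_t\in\mathbb{R}^{n_y}$, and let $n$ be its McMillan degree. Let $w^d=(u^d,y^d)$ be a noise-free external trajectory of length $N$ generated exactly by this system, and suppose that the input component $u^d$ is persistently exciting of order $L+n$. (More generally, persistency of excitation of order $L+\bar n$ is sufficient for any known upper bound $\bar n\ge n$; in particular, the state dimension $n_x$ of a realization is a valid upper bound.) Let $H_L(w^d)\in\mathbb{R}^{L(n_u+n_y)\times(N-L+1)}$ be the Hankel matrix built from $w^d$. Then the behavioral-measure set on external trajectories $\mathcal{M}_{\mathcal{B}}^L$ satisfies $$\mathcal{M}_{\mathcal{B}}^{L}=\bigl\{(H_L(w^d))_{\#}\nu:\ \nu\in\mathcal{P}(\mathbb{R}^{N-L+1})\bigr\}.$$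
   Context: $\mathcal{P}(S)$ denotes the Borel probability measures on $S$; $\varphi_{\#}\mu$ the pushforward of $\mu$ under $\varphi$, and a matrix is identified with the linear map it defines. The external signal is $w_t=(u_t,y_t)\in\mathbb{R}^{n_u+n_y}$ and $\mathcal{W}_L:=(\mathbb{R}^{n_u+n_y})^L$. The finite-horizon external behavior $\mathcal{B}_L\subseteq\mathcal{W}_L$ is the set of all $(w_0,\dots,w_{L-1})$ with $w_t=(u_t,y_t)$ for which there is a state sequence (with free initial state $x_0$) satisfying the system equations for $t=0,\dots,L-1$. The external behavioral-measure set is $\mathcal{M}_{\mathcal{B}}^L:=\mathcal{P}(\mathcal{B}_L)$, i.e. the Borel probability measures on $\mathcal{W}_L$ supported on $\mathcal{B}_L$. Controllable means that the pair $(A,B)$ is controllable. The McMillan degree is the smallest state dimension of a realization of the transfer function $D+C(zI-A)^{-1}B$. For data $w^d=(w_0^d,\dots,w_{N-1}^d)$ with $w_t^d=(u_t^d,y_t^d)$, $H_L(w^d)$ is the block Hankel matrix whose $j$-th column ($j=0,\dots,N-L$) is the stacked window $(w_j^d,w_{j+1}^d,\dots,w_{j+L-1}^d)$. A signal $u^d$ of length $N$ in $\mathbb{R}^{n_u}$ is persistently exciting of order $K$ if its depth-$K$ block Hankel matrix $H_K(u^d)$ has full row rank $Kn_u$. *)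

theory Defs
  imports
    "HOL-Probability.Probability"
    "Jordan_Normal_Form.Gauss_Jordan_Elimination"
    "Jordan_Normal_Form.Char_Poly"
    "Jordan_Normal_Form.DL_Rank"
begin

text \<open>
  All dimensions are natural numbers, since the McMillan degree is a minimum over systems of
  varying state dimension and the window length is a parameter. Vectors and matrices are
  therefore those of Jordan_Normal_Form, and the vector notation of HOL-Analysis is disabled.
\<close>

unbundle no vec_syntax

type_synonym rvec = "real Matrix.vec"
type_synonym rmat = "real Matrix.mat"


subsection \<open>Borel probability measures on finite-dimensional real space\<close>

text \<open>Library vectors carry no topology; they get the one of the product of \<open>m\<close> real lines.\<close>

definition vec_topology :: "nat \<Rightarrow> rvec topology" where
  "vec_topology m =
     pullback_topology (carrier_vec m) (\<lambda>v. \<lambda>i\<in>{..<m}. v $ i)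
       (product_topology (\<lambda>_. euclideanreal) {..<m})"

definition vec_borel :: "nat \<Rightarrow> rvec measure" where
  "vec_borel m = sigma (carrier_vec m) {U. openin (vec_topology m) U}"

definition vec_probs :: "nat \<Rightarrow> rvec measure set" where
  "vec_probs m = {\<mu>. prob_space \<mu> \<and> sets \<mu> = sets (vec_borel m)}"

definition vec_probs_on :: "nat \<Rightarrow> rvec set \<Rightarrow> rvec measure set" where
  "vec_probs_on m S = {\<mu> \<in> vec_probs m. S \<in> sets (vec_borel m) \<and> emeasure \<mu> S = 1}"

definition mat_push :: "rmat \<Rightarrow> rvec measure \<Rightarrow> rvec measure" where
  "mat_push M \<nu> = distr \<nu> (vec_borel (dim_row M)) (\<lambda>g. M *\<^sub>v g)"


subsection \<open>Linear time-invariant systems\<close>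

definition lti_system :: "nat \<Rightarrow> nat \<Rightarrow> nat \<Rightarrow> rmat \<Rightarrow> rmat \<Rightarrow> rmat \<Rightarrow> rmat \<Rightarrow> bool" where
  "lti_system nx nu ny A B C D \<longleftrightarrow>
     A \<in> carrier_mat nx nx \<and> B \<in> carrier_mat nx nu \<and>
     C \<in> carrier_mat ny nx \<and> D \<in> carrier_mat ny nu"

definition controllable :: "nat \<Rightarrow> nat \<Rightarrow> rmat \<Rightarrow> rmat \<Rightarrow> bool" where
  "controllable nx nu A B \<longleftrightarrow>
     (\<forall>\<xi> \<in> carrier_vec nx. \<forall>\<eta> \<in> carrier_vec nx. \<exists>T (u :: nat \<Rightarrow> rvec) (x :: nat \<Rightarrow> rvec).
        (\<forall>t<T. u t \<in> carrier_vec nu) \<and> x 0 = \<xi> \<and>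
        (\<forall>t<T. x (Suc t) = A *\<^sub>v x t + B *\<^sub>v u t) \<and> x T = \<eta>)"

text \<open>Only the values of the signals \<open>u\<close>, \<open>y\<close> at times \<open>t < T\<close> matter; the initial state is free.\<close>

definition generates ::
  "nat \<Rightarrow> nat \<Rightarrow> nat \<Rightarrow> rmat \<Rightarrow> rmat \<Rightarrow> rmat \<Rightarrow> rmat \<Rightarrow> nat \<Rightarrow> (nat \<Rightarrow> rvec) \<Rightarrow> (nat \<Rightarrow> rvec) \<Rightarrow> bool" where
  "generates nx nu ny A B C D T u y \<longleftrightarrow>
     (\<forall>t<T. u t \<in> carrier_vec nu \<and> y t \<in> carrier_vec ny) \<and>
     (\<exists>x. x 0 \<in> carrier_vec nx \<and>
        (\<forall>t<T. x (Suc t) = A *\<^sub>v x t + B *\<^sub>v u t \<and> y t = C *\<^sub>v x t + D *\<^sub>v u t))"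

definition external_signal :: "(nat \<Rightarrow> rvec) \<Rightarrow> (nat \<Rightarrow> rvec) \<Rightarrow> nat \<Rightarrow> rvec" where
  "external_signal u y = (\<lambda>t. u t @\<^sub>v y t)"

text \<open>The window \<open>w j, \<dots>, w (j + L - 1)\<close> of a signal with values of length \<open>q\<close>, stacked into
  one vector of length \<open>L * q\<close>. This is how sequences of \<open>L\<close> such values are represented.\<close>

definition window :: "nat \<Rightarrow> nat \<Rightarrow> (nat \<Rightarrow> rvec) \<Rightarrow> nat \<Rightarrow> rvec" where
  "window q L w j = Matrix.vec (L * q) (\<lambda>i. w (j + i div q) $ (i mod q))"

definition external_behavior ::
  "nat \<Rightarrow> nat \<Rightarrow> nat \<Rightarrow> rmat \<Rightarrow> rmat \<Rightarrow> rmat \<Rightarrow> rmat \<Rightarrow> nat \<Rightarrow> rvec set" where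
  "external_behavior nx nu ny A B C D L =
     {window (nu + ny) L (external_signal u y) 0 | u y. generates nx nu ny A B C D L u y}"

definition behavioral_measures ::
  "nat \<Rightarrow> nat \<Rightarrow> nat \<Rightarrow> rmat \<Rightarrow> rmat \<Rightarrow> rmat \<Rightarrow> rmat \<Rightarrow> nat \<Rightarrow> rvec measure set" where
  "behavioral_measures nx nu ny A B C D L =
     vec_probs_on (L * (nu + ny)) (external_behavior nx nu ny A B C D L)"


subsection \<open>Transfer function and McMillan degree\<close>

text \<open>
  Entries are rational functions in \<open>z\<close>, i.e. elements of the fraction field of \<open>real poly\<close>.
  \<open>char_poly_matrix A\<close> is the polynomial matrix \<open>zI - A\<close>; its determinant is monic, so the
  inverse over the fraction field always exists and \<open>the\<close> is applied to \<open>Some\<close>.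
\<close>

definition const_mat :: "rmat \<Rightarrow> real poly fract Matrix.mat" where
  "const_mat = map_mat (\<lambda>a. to_fract [:a:])"

definition transfer_function :: "rmat \<Rightarrow> rmat \<Rightarrow> rmat \<Rightarrow> rmat \<Rightarrow> real poly fract Matrix.mat" where
  "transfer_function A B C D =
     const_mat D +
     const_mat C * the (mat_inverse (map_mat to_fract (char_poly_matrix A))) * const_mat B"

definition mcmillan_degree :: "nat \<Rightarrow> nat \<Rightarrow> real poly fract Matrix.mat \<Rightarrow> nat" where
  "mcmillan_degree nu ny G =
     (LEAST m. \<exists>A B C D. lti_system m nu ny A B C D \<and> transfer_function A B C D = G)"


subsection \<open>Hankel matrices and persistency of excitation\<close>

text \<open>Only the first \<open>N\<close> values of the signal enter. The number of columns is written
  \<open>N + 1 - L\<close> so that natural-number subtraction gives no spurious column when \<open>N < L\<close>.\<close>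

definition hankel :: "nat \<Rightarrow> nat \<Rightarrow> nat \<Rightarrow> (nat \<Rightarrow> rvec) \<Rightarrow> rmat" where
  "hankel q L N w = mat_of_cols (L * q) (map (window q L w) [0..<N + 1 - L])"

definition persistently_exciting :: "nat \<Rightarrow> nat \<Rightarrow> (nat \<Rightarrow> rvec) \<Rightarrow> nat \<Rightarrow> bool" where
  "persistently_exciting nu N u K \<longleftrightarrow> vec_space.rank (K * nu) (hankel nu K N u) = K * nu"

end

theory Submission
  imports Defs
begin

text \<open>
  The measure statement reduces to linear algebra. If the subspace \<open>\<B>\<close> of behaviors is the range
  of the Hankel matrix \<open>H\<close>, a generalized inverse \<open>K\<close> (a matrix with \<open>H K H = H\<close>) does the rest:
  \<open>H K\<close> fixes every point of \<open>\<B>\<close>, so a measure concentrated on \<open>\<B>\<close> is the pushforward under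
  \<open>H\<close> of its own pushforward under \<open>K\<close>; conversely a pushforward under \<open>H\<close> lives on
  the range of \<open>H\<close>, which is closed, being the solution set of \<open>H K v = v\<close>
  (\<open>vec_probs_on_range\<close>).
  
  That the range of \<open>H\<close> is \<open>\<B>\<close> is a form of the fundamental lemma of Willems and coauthors. Combinations
  of data windows are behaviors by linearity. For the converse it is enough that each linear
  functional \<open>a\<close> on windows that annihilates all data windows annihilates all behaviors
  (\<open>in_range_if_annihilated\<close>). Eliminating the outputs, \<open>a\<close> becomes
  \<open>p \<bullet> x(j) + (a combination of u(j), \<dots>, u(j + L - 1))\<close> along any trajectory, where \<open>p\<close>
  lies in the span of the rows \<open>C A\<^sup>k\<close>; so \<open>p\<close> and the input coefficients have to
  be shown to vanish (\<open>data_relation_trivial\<close>). Shifting the relation in time replaces \<open>p \<bullet> x\<close> by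
  \<open>p \<bullet> A\<^sup>k x\<close> at the price of \<open>k\<close> more inputs. If \<open>c\<close> is monic of
  degree \<open>K\<close> and \<open>p c(A) = 0\<close>, the combination of the shifts with the coefficients of \<open>c\<close> involves
  only inputs, over \<open>L + K\<close> time steps, and persistency of excitation makes all its coefficients zero. As \<open>c\<close> is
  monic these coefficients form a triangular system, which gives that the input coefficients
  and all \<open>p A\<^sup>k B\<close> vanish; by controllability \<open>p = 0\<close>.
  
  The order of excitation is thus the degree of a monic \<open>c\<close> with \<open>C c(A) = 0\<close>, and the point
  is that the McMillan degree \<open>n\<close> suffices although \<open>A\<close> itself may be larger. The
  characteristic polynomial \<open>\<chi>'\<close> of a minimal realization works
  (\<open>transfer_function_annihilating_poly\<close>): it clears the denominators of the common transfer function, so that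
  \<open>\<chi>' C (zI - A)\<^sup>-\<^sup>1 B\<close> is polynomial. Modulo polynomials this equals
  \<open>C \<chi>'(A) (zI - A)\<^sup>-\<^sup>1 B\<close>, which is strictly proper and therefore zero, so \<open>C \<chi>'(A) A\<^sup>k B = 0\<close>
  for all \<open>k\<close> and controllability gives \<open>C \<chi>'(A) = 0\<close>. Multiples of \<open>\<chi>'\<close> by powers of \<open>z\<close> have
  the same property, which covers every order \<open>nbar \<ge> n\<close>.
\<close>

(* In this theory the dot denotes the scalar product of vectors of explicit dimension. *)
unbundle no inner_syntax

section \<open>Generalized inverses of real matrices\<close>

lemma scalar_prod_mult_mat_vec:
  fixes M :: "'a :: comm_semiring_0 Matrix.mat"
  assumes "M \<in> carrier_mat r c" "a \<in> carrier_vec r" "g \<in> carrier_vec c"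
  shows "a \<bullet> (M *\<^sub>v g) = (\<Sum>j<c. g $ j * (a \<bullet> col M j))"
proof -
  have "a \<bullet> (M *\<^sub>v g) = (\<Sum>i<r. \<Sum>j<c. a $ i * (M $$ (i, j) * g $ j))"
    using assms by (simp add: scalar_prod_def lessThan_atLeast0 sum_distrib_left)
  also have "\<dots> = (\<Sum>j<c. \<Sum>i<r. a $ i * (M $$ (i, j) * g $ j))"
    by (rule sum.swap)
  also have "\<dots> = (\<Sum>j<c. g $ j * (a \<bullet> col M j))"
    using assms by (simp add: scalar_prod_def lessThan_atLeast0 sum_distrib_left mult_ac)
  finally show ?thesis .
qed

lemma scalar_prod_self_eq_0:
  assumes "(v :: rvec) \<in> carrier_vec n"
  shows "v \<bullet> v = 0 \<longleftrightarrow> v = 0\<^sub>v n"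
proof -
  have "conjugate v = v" by (simp add: vec_eq_iff)
  then show ?thesis using conjugate_square_eq_0_vec[OF assms] by simp
qed

lemma mat_of_cols_Cons_mult_vec:
  fixes h :: "'a :: comm_semiring_0 Matrix.vec"
  assumes "h \<in> carrier_vec n" "k \<in> carrier_vec (length vs)"
  shows "mat_of_cols n (h # vs) *\<^sub>v vCons a k = a \<cdot>\<^sub>v h + mat_of_cols n vs *\<^sub>v k"
proof
  fix i assume i: "i < dim_vec (a \<cdot>\<^sub>v h + mat_of_cols n vs *\<^sub>v k)"
  then have "i < n" by simp
  then show "(mat_of_cols n (h # vs) *\<^sub>v vCons a k) $ i = (a \<cdot>\<^sub>v h + mat_of_cols n vs *\<^sub>v k) $ i"
    using assms
    by (simp add: scalar_prod_def mat_of_cols_def sum.atLeast0_lessThan_Suc_shift mult.commute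
        del: sum.op_ivl_Suc)
qed simp

text \<open>
  Induction on the columns. A new column \<open>h\<close> leaves the residue \<open>r = h - H K h\<close> modulo the
  old ones. The functional \<open>\<phi>\<close> proportional to \<open>v \<mapsto> r \<bullet> (v - H K v)\<close> vanishes on the old columns and is \<open>1\<close> on \<open>h\<close>
  unless \<open>r = 0\<close>, so it can serve as the coefficient of \<open>h\<close>.
\<close>

lemma columns_generalized_inverse:
  assumes "set vs \<subseteq> carrier_vec n"
  shows "\<exists>K \<in> carrier_mat (length vs) n.
           \<forall>v \<in> set vs. mat_of_cols n vs *\<^sub>v (K *\<^sub>v v) = (v :: rvec)"
  using assms
proof (induction vs)
  case Nil
  show ?case by (intro bexI[of _ "0\<^sub>m 0 n"]) auto
next
  case (Cons h vs)
  define m where "m = length vs"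
  define H where "H = mat_of_cols n vs"
  have h: "h \<in> carrier_vec n" and H: "H \<in> carrier_mat n m"
    using Cons.prems by (auto simp: H_def m_def)
  obtain K where K: "K \<in> carrier_mat m n" and HK: "\<And>v. v \<in> set vs \<Longrightarrow> H *\<^sub>v (K *\<^sub>v v) = v"
    using Cons by (auto simp: H_def m_def)
  define r where "r = h - H *\<^sub>v (K *\<^sub>v h)"
  \<comment> \<open>If \<open>r = 0\<close>, division by zero makes \<open>\<phi> = 0\<close>, which is the right choice then.\<close>
  define \<phi> where "\<phi> = (1 / (r \<bullet> r)) \<cdot>\<^sub>v (r - (H * K)\<^sup>T *\<^sub>v r)"
  have r: "r \<in> carrier_vec n" using h H K by (auto simp: r_def)
  have \<phi>: "\<phi> \<in> carrier_vec n" using K by (intro carrier_vecI) (simp add: \<phi>_def)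
  have \<phi>_apply: "\<phi> \<bullet> v = r \<bullet> (v - H *\<^sub>v (K *\<^sub>v v)) / (r \<bullet> r)" if v: "v \<in> carrier_vec n" for v
  proof -
    have "((H * K)\<^sup>T *\<^sub>v r) \<bullet> v = r \<bullet> (H *\<^sub>v (K *\<^sub>v v))"
      using transpose_vec_mult_scalar[of "H * K" n n v r] v r H K
      by (simp add: assoc_mult_mat_vec[of H n m K n v])
    moreover have "(H * K)\<^sup>T *\<^sub>v r \<in> carrier_vec n" using K by (intro carrier_vecI) simp
    ultimately show ?thesis
      using v r H K unfolding \<phi>_def
      by (simp add: minus_scalar_prod_distrib[of _ n] scalar_prod_minus_distrib[of _ n])
  qed
  have "r \<noteq> 0\<^sub>v n \<Longrightarrow> r \<bullet> r \<noteq> 0"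
    using r by (simp add: scalar_prod_self_eq_0)
  then have \<phi>_h: "r \<noteq> 0\<^sub>v n \<Longrightarrow> \<phi> \<bullet> h = 1"
    using \<phi>_apply[OF h] r_def by simp
  define K' where "K' = mat (Suc m) n
     (\<lambda>(i, j). if i = 0 then \<phi> $ j else K $$ (i - 1, j) - (K *\<^sub>v h) $ (i - 1) * \<phi> $ j)"
  have K': "K' \<in> carrier_mat (Suc m) n" by (simp add: K'_def)
  have K'_apply: "K' *\<^sub>v v = vCons (\<phi> \<bullet> v) (K *\<^sub>v v - (\<phi> \<bullet> v) \<cdot>\<^sub>v (K *\<^sub>v h))"
    if v: "v \<in> carrier_vec n" for v
  proof
    show "dim_vec (K' *\<^sub>v v) = dim_vec (vCons (\<phi> \<bullet> v) (K *\<^sub>v v - (\<phi> \<bullet> v) \<cdot>\<^sub>v (K *\<^sub>v h)))"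
      using K by (simp add: K'_def)
    fix i assume "i < dim_vec (vCons (\<phi> \<bullet> v) (K *\<^sub>v v - (\<phi> \<bullet> v) \<cdot>\<^sub>v (K *\<^sub>v h)))"
    then have i: "i < Suc m" using K by simp
    show "(K' *\<^sub>v v) $ i = vCons (\<phi> \<bullet> v) (K *\<^sub>v v - (\<phi> \<bullet> v) \<cdot>\<^sub>v (K *\<^sub>v h)) $ i"
    proof (cases i)
      case 0
      then show ?thesis using v \<phi> i by (simp add: K'_def scalar_prod_def)
    next
      case (Suc l)
      have "(\<Sum>j<n. (K $$ (l, j) - (K *\<^sub>v h) $ l * \<phi> $ j) * v $ j)
          = (\<Sum>j<n. K $$ (l, j) * v $ j) - (\<Sum>j<n. \<phi> $ j * v $ j) * (K *\<^sub>v h) $ l"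
        by (simp add: sum_subtractf sum_distrib_left algebra_simps)
      then show ?thesis using v \<phi> i K h Suc
        by (simp add: K'_def scalar_prod_def lessThan_atLeast0 cong: if_cong)
    qed
  qed
  have split: "mat_of_cols n (h # vs) *\<^sub>v (K' *\<^sub>v v)
      = H *\<^sub>v (K *\<^sub>v v) + (\<phi> \<bullet> v) \<cdot>\<^sub>v r" if v: "v \<in> carrier_vec n" for v
  proof -
    have "H *\<^sub>v (K *\<^sub>v v - (\<phi> \<bullet> v) \<cdot>\<^sub>v (K *\<^sub>v h))
        = H *\<^sub>v (K *\<^sub>v v) - (\<phi> \<bullet> v) \<cdot>\<^sub>v (H *\<^sub>v (K *\<^sub>v h))"
      using H K v h
      by (simp add: mult_minus_distrib_mat_vec[of _ n m] mult_mat_vec[of _ n m])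
    then show ?thesis
      using H K v h by (auto simp: K'_apply mat_of_cols_Cons_mult_vec m_def r_def
          simp flip: H_def simp: algebra_simps)
  qed
  have "mat_of_cols n (h # vs) *\<^sub>v (K' *\<^sub>v v) = v" if v: "v \<in> set (h # vs)" for v
  proof (cases "v \<in> set vs")
    case True
    then have "v \<in> carrier_vec n" using Cons.prems by auto
    moreover have "0 \<cdot>\<^sub>v r = 0\<^sub>v n" using r by (intro eq_vecI) auto
    ultimately show ?thesis using HK[OF True] r by (simp add: split \<phi>_apply)
  next
    case False
    then have "v = h" using v by simp
    show ?thesis
    proof (cases "r = 0\<^sub>v n")
      case True
      then have "H *\<^sub>v (K *\<^sub>v h) = h" using h H K
        by (auto simp: r_def vec_eq_iff)
      moreover have "(\<phi> \<bullet> h) \<cdot>\<^sub>v 0\<^sub>v n = 0\<^sub>v n" by (intro eq_vecI) auto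
      ultimately show ?thesis using True \<open>v = h\<close> h by (simp add: split)
    next
      case False
      then show ?thesis using \<open>v = h\<close> h H K by (auto simp: split \<phi>_h r_def)
    qed
  qed
  then show ?case using K' by (auto simp: m_def)
qed

lemma generalized_inverse:
  assumes H: "(H :: rmat) \<in> carrier_mat n m"
  obtains K where "K \<in> carrier_mat m n"
    "\<And>g. g \<in> carrier_vec m \<Longrightarrow> H *\<^sub>v (K *\<^sub>v (H *\<^sub>v g)) = H *\<^sub>v g"
proof -
  have "set (cols H) \<subseteq> carrier_vec n" using H cols_dim by blast
  from columns_generalized_inverse[OF this]
  obtain K where K: "K \<in> carrier_mat m n"
    and HK: "\<And>v. v \<in> set (cols H) \<Longrightarrow> H *\<^sub>v (K *\<^sub>v v) = v"
    using H mat_of_cols_cols[of H] by auto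
  have "H * (K * H) = H"
  proof (rule mat_col_eqI)
    fix j assume "j < dim_col H"
    then show "col (H * (K * H)) j = col H j"
      using HK[of "col H j"] H K
      by (simp add: cols_def col_mult2[of _ n m _ m] col_mult2[of _ m n _ m] del: col_mult)
  qed (use H K in auto)
  then have "H *\<^sub>v (K *\<^sub>v (H *\<^sub>v g)) = H *\<^sub>v g" if "g \<in> carrier_vec m" for g
    using that H K assoc_mult_mat_vec[of H n m "K * H" m g] assoc_mult_mat_vec[of K m n H m g] by simp
  with K that show thesis by blast
qed

text \<open>
  Duality without dimension counting: the rows of \<open>I - H K\<close> annihilate the columns of \<open>H\<close>, hence
  \<open>v\<close>, which means \<open>v = H (K v)\<close>.
\<close>

lemma in_range_if_annihilated:
  assumes H: "(H :: rmat) \<in> carrier_mat n m" and v: "v \<in> carrier_vec n"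
    and ann: "\<And>a. a \<in> carrier_vec n \<Longrightarrow> (\<And>j. j < m \<Longrightarrow> a \<bullet> col H j = 0) \<Longrightarrow> a \<bullet> v = 0"
  shows "\<exists>g \<in> carrier_vec m. v = H *\<^sub>v g"
proof -
  obtain K where K: "K \<in> carrier_mat m n"
    and HK: "\<And>g. g \<in> carrier_vec m \<Longrightarrow> H *\<^sub>v (K *\<^sub>v (H *\<^sub>v g)) = H *\<^sub>v g"
    using generalized_inverse[OF H] by blast
  have defect: "row (1\<^sub>m n - H * K) i \<bullet> x = (x - H *\<^sub>v (K *\<^sub>v x)) $ i"
    if "i < n" "x \<in> carrier_vec n" for i x
  proof -
    have "row (1\<^sub>m n - H * K) i \<bullet> x = ((1\<^sub>m n - H * K) *\<^sub>v x) $ i"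
      using that H K by simp
    also have "(1\<^sub>m n - H * K) *\<^sub>v x = x - H *\<^sub>v (K *\<^sub>v x)"
      using that H K by (simp add: minus_mult_distrib_mat_vec[of _ n n] assoc_mult_mat_vec[of H n m K n x])
    finally show ?thesis .
  qed
  have "(v - H *\<^sub>v (K *\<^sub>v v)) $ i = 0" if i: "i < n" for i
  proof -
    have "row (1\<^sub>m n - H * K) i \<bullet> col H j = 0" if j: "j < m" for j
    proof -
      have "col H j = H *\<^sub>v unit_vec m j" using H j by (intro eq_vecI) auto
      then show ?thesis using HK[of "unit_vec m j"] i H by (simp add: defect)
    qed
    moreover have "row (1\<^sub>m n - H * K) i \<in> carrier_vec n" using H K i by (intro carrier_vecI) simp
    ultimately show ?thesis using ann[of "row (1\<^sub>m n - H * K) i"] defect[OF i v] by simp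
  qed
  then have "v = H *\<^sub>v (K *\<^sub>v v)" using v H K by (auto simp: vec_eq_iff)
  then show ?thesis using H K v by auto
qed

section \<open>Measures on the range of a matrix\<close>

lemma topspace_vec_topology: "topspace (vec_topology m) = carrier_vec m"
  by (auto simp: vec_topology_def topspace_pullback_topology)

lemma open_sets_vec_topology: "{U. openin (vec_topology m) U} \<subseteq> Pow (carrier_vec m)"
proof
  fix U assume "U \<in> {U. openin (vec_topology m) U}"
  then have "U \<subseteq> topspace (vec_topology m)" by (simp add: openin_subset)
  then show "U \<in> Pow (carrier_vec m)" by (simp add: topspace_vec_topology)
qed

lemma space_vec_borel [simp]: "space (vec_borel m) = carrier_vec m"
  unfolding vec_borel_def by (rule space_measure_of[OF open_sets_vec_topology])

lemma sets_vec_borel: "sets (vec_borel m) = sigma_sets (carrier_vec m) {U. openin (vec_topology m) U}"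
  unfolding vec_borel_def by (rule sets_measure_of[OF open_sets_vec_topology])

lemma closedin_vec_borel:
  assumes "closedin (vec_topology m) S"
  shows "S \<in> sets (vec_borel m)"
proof -
  have "carrier_vec m - S \<in> sets (vec_borel m)" (is "?T \<in> _")
    using assms by (auto simp: closedin_def topspace_vec_topology sets_vec_borel)
  from sets.compl_sets[OF this] have "carrier_vec m - ?T \<in> sets (vec_borel m)" by simp
  moreover have "carrier_vec m - ?T = S"
    using closedin_subset[OF assms] by (auto simp: topspace_vec_topology)
  ultimately show ?thesis by simp
qed

lemma continuous_map_scalar_prod:
  assumes "a \<in> carrier_vec m"
  shows "continuous_map (vec_topology m) euclideanreal (\<lambda>v. a \<bullet> v)"
proof -
  have coord: "continuous_map (vec_topology m) euclideanreal (\<lambda>v. v $ i)" if i: "i < m" for i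
  proof -
    have "continuous_map (vec_topology m) euclideanreal ((\<lambda>f. f i) \<circ> (\<lambda>v. \<lambda>i\<in>{..<m}. v $ i))"
      unfolding vec_topology_def
      by (rule continuous_map_pullback, rule continuous_map_product_projection) (use i in auto)
    then show ?thesis by (rule continuous_map_eq) (use i in auto)
  qed
  have "continuous_map (vec_topology m) euclideanreal (\<lambda>v. \<Sum>i<m. a $ i * v $ i)"
    by (intro continuous_map_sum continuous_map_real_mult_left coord) auto
  then show ?thesis
    by (rule continuous_map_eq) (auto simp: scalar_prod_def lessThan_atLeast0 topspace_vec_topology)
qed

text \<open>
  Measurability of matrix maps is derived from continuity alone, so that the Borel sets need not
  be compared with the product of one-dimensional Borel \<open>\<sigma>\<close>-algebras.
\<close>

lemma continuous_map_mult_mat_vec: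
  assumes M: "M \<in> carrier_mat k m"
  shows "continuous_map (vec_topology m) (vec_topology k) (\<lambda>v. M *\<^sub>v v)"
proof -
  have "continuous_map (vec_topology m) euclideanreal (\<lambda>v. (M *\<^sub>v v) $ i)" if "i < k" for i
    by (rule continuous_map_eq[OF continuous_map_scalar_prod[of "row M i"]]) (use M that in auto)
  then have "continuous_map (vec_topology m) (product_topology (\<lambda>_. euclideanreal) {..<k})
          ((\<lambda>v. \<lambda>i\<in>{..<k}. v $ i) \<circ> (\<lambda>v. M *\<^sub>v v))"
    using M by (auto simp: continuous_map_componentwise o_def)
  then show ?thesis
    unfolding vec_topology_def[of k]
    by (rule continuous_map_pullback') (use M in \<open>auto simp: topspace_vec_topology\<close>)
qed

lemma measurable_mult_mat_vec:
  assumes "M \<in> carrier_mat k m"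
  shows "(\<lambda>v. M *\<^sub>v v) \<in> vec_borel m \<rightarrow>\<^sub>M vec_borel k"
  unfolding vec_borel_def[of k]
proof (rule measurable_measure_of)
  show "{U. openin (vec_topology k) U} \<subseteq> Pow (carrier_vec k)" by (rule open_sets_vec_topology)
  show "(\<lambda>v. M *\<^sub>v v) \<in> space (vec_borel m) \<rightarrow> carrier_vec k" using assms by simp
  fix U assume "U \<in> {U. openin (vec_topology k) U}"
  then have "openin (vec_topology m) {v \<in> topspace (vec_topology m). M *\<^sub>v v \<in> U}"
    using continuous_map_mult_mat_vec[OF assms] by (auto simp: continuous_map_def)
  moreover have "(\<lambda>v. M *\<^sub>v v) -` U \<inter> space (vec_borel m)
      = {v \<in> topspace (vec_topology m). M *\<^sub>v v \<in> U}"
    by (auto simp: topspace_vec_topology)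
  ultimately show "(\<lambda>v. M *\<^sub>v v) -` U \<inter> space (vec_borel m) \<in> sets (vec_borel m)"
    by (simp add: sets_vec_borel)
qed

text \<open>
  The range is closed because it is the kernel of \<open>H K - I\<close>.
\<close>

lemma range_mat_in_vec_borel:
  assumes H: "H \<in> carrier_mat n m"
  shows "(\<lambda>g. H *\<^sub>v g) ` carrier_vec m \<in> sets (vec_borel n)"
proof -
  obtain K where K: "K \<in> carrier_mat m n"
    and HK: "\<And>g. g \<in> carrier_vec m \<Longrightarrow> H *\<^sub>v (K *\<^sub>v (H *\<^sub>v g)) = H *\<^sub>v g"
    using generalized_inverse[OF H] by blast
  define E where "E = H * K - 1\<^sub>m n"
  have E: "E \<in> carrier_mat n n" using H K by (auto simp: E_def)
  have E_apply: "E *\<^sub>v v = H *\<^sub>v (K *\<^sub>v v) - v" if "v \<in> carrier_vec n" for v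
    using that H K unfolding E_def
    by (simp add: minus_mult_distrib_mat_vec[of _ n n] assoc_mult_mat_vec[of H n m K n v])
  have "(\<lambda>g. H *\<^sub>v g) ` carrier_vec m
      = {v \<in> carrier_vec n. \<forall>i<n. row E i \<bullet> v = 0}"
  proof (intro equalityI subsetI)
    fix v assume "v \<in> (\<lambda>g. H *\<^sub>v g) ` carrier_vec m"
    then have v: "v \<in> carrier_vec n" and "H *\<^sub>v (K *\<^sub>v v) = v" using H HK by auto
    then have "E *\<^sub>v v = 0\<^sub>v n" by (simp add: E_apply)
    then have "\<forall>i<n. (E *\<^sub>v v) $ i = 0" by simp
    then show "v \<in> {v \<in> carrier_vec n. \<forall>i<n. row E i \<bullet> v = 0}"
      using v E by auto
  next
    fix v assume "v \<in> {v \<in> carrier_vec n. \<forall>i<n. row E i \<bullet> v = 0}"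
    then have v: "v \<in> carrier_vec n" and "\<forall>i<n. (E *\<^sub>v v) $ i = 0" using E by auto
    then have "H *\<^sub>v (K *\<^sub>v v) = v" using H K by (auto simp: E_apply vec_eq_iff)
    then show "v \<in> (\<lambda>g. H *\<^sub>v g) ` carrier_vec m"
      using K v by (intro image_eqI[of _ _ "K *\<^sub>v v"]) auto
  qed
  also have "\<dots> = {v \<in> carrier_vec n. \<forall>i\<in>{..<n}. row E i \<bullet> v = 0}" by auto
  also have "closedin (vec_topology n) \<dots>"
  proof (cases "n = 0")
    case True
    then show ?thesis by (simp flip: topspace_vec_topology)
  next
    case False
    have "closedin (vec_topology n) {v \<in> topspace (vec_topology n). row E i \<bullet> v \<in> {0}}" if "i < n" for i
      using E that by (intro closedin_continuous_map_preimage[OF continuous_map_scalar_prod]) auto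
    then have "closedin (vec_topology n) (\<Inter>i\<in>{..<n}. {v \<in> carrier_vec n. row E i \<bullet> v = 0})"
      using False by (intro closedin_INT) (auto simp: topspace_vec_topology)
    moreover have "(\<Inter>i\<in>{..<n}. {v \<in> carrier_vec n. row E i \<bullet> v = 0})
        = {v \<in> carrier_vec n. \<forall>i\<in>{..<n}. row E i \<bullet> v = 0}" using False by auto
    ultimately show ?thesis by simp
  qed
  finally show ?thesis by (rule closedin_vec_borel)
qed

text \<open>
  A measure \<open>\<mu>\<close> concentrated on the range of \<open>H\<close> is recovered from its pushforward under a
  generalized inverse \<open>K\<close>, since \<open>H K\<close> is the identity \<open>\<mu>\<close>-almost everywhere.
\<close>

lemma vec_probs_on_range:
  assumes H: "H \<in> carrier_mat n m"
  shows "vec_probs_on n ((\<lambda>g. H *\<^sub>v g) ` carrier_vec m) = {mat_push H \<nu> | \<nu>. \<nu> \<in> vec_probs m}"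
    (is "vec_probs_on n ?S = _")
proof (intro equalityI subsetI)
  have push_prob: "mat_push M \<nu> \<in> vec_probs k" if "M \<in> carrier_mat k l" "\<nu> \<in> vec_probs l" for M \<nu> k l
  proof -
    have "(\<lambda>v. M *\<^sub>v v) \<in> \<nu> \<rightarrow>\<^sub>M vec_borel k"
      using that measurable_mult_mat_vec[of M k l] by (auto simp: vec_probs_def cong: measurable_cong_sets)
    then show ?thesis using that
      by (auto simp: vec_probs_def mat_push_def intro: prob_space.prob_space_distr)
  qed
  {
    fix \<mu> assume "\<mu> \<in> {mat_push H \<nu> | \<nu>. \<nu> \<in> vec_probs m}"
    then obtain \<nu> where \<nu>: "\<nu> \<in> vec_probs m" and \<mu>: "\<mu> = mat_push H \<nu>" by auto
    have sets: "sets \<nu> = sets (vec_borel m)" and "prob_space \<nu>" using \<nu> by (auto simp: vec_probs_def)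
    interpret prob_space \<nu> by fact
    have space: "space \<nu> = carrier_vec m" using sets_eq_imp_space_eq[OF sets] by simp
    have "(\<lambda>v. H *\<^sub>v v) \<in> \<nu> \<rightarrow>\<^sub>M vec_borel n"
      using measurable_mult_mat_vec[OF H] sets by (simp cong: measurable_cong_sets)
    then have "emeasure \<mu> ?S = emeasure \<nu> ((\<lambda>v. H *\<^sub>v v) -` ?S \<inter> space \<nu>)"
      using H range_mat_in_vec_borel[OF H] by (simp add: \<mu> mat_push_def emeasure_distr)
    also have "(\<lambda>v. H *\<^sub>v v) -` ?S \<inter> space \<nu> = space \<nu>" using space by auto
    finally have "emeasure \<mu> ?S = 1" by (simp add: emeasure_space_1)
    then show "\<mu> \<in> vec_probs_on n ?S"
      using push_prob[OF H \<nu>] range_mat_in_vec_borel[OF H] by (simp add: vec_probs_on_def \<mu>)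
  next
    fix \<mu> assume \<mu>: "\<mu> \<in> vec_probs_on n ?S"
    then have sets: "sets \<mu> = sets (vec_borel n)" and "prob_space \<mu>"
      by (auto simp: vec_probs_on_def vec_probs_def)
    interpret prob_space \<mu> by fact
    obtain K where K: "K \<in> carrier_mat m n"
      and HK: "\<And>g. g \<in> carrier_vec m \<Longrightarrow> H *\<^sub>v (K *\<^sub>v (H *\<^sub>v g)) = H *\<^sub>v g"
      using generalized_inverse[OF H] by blast
    have K_meas: "(\<lambda>v. K *\<^sub>v v) \<in> \<mu> \<rightarrow>\<^sub>M vec_borel m"
      using measurable_mult_mat_vec[OF K] sets by (simp cong: measurable_cong_sets)
    have "prob ?S = 1" using \<mu> by (simp add: vec_probs_on_def measure_def)
    then have "AE v in \<mu>. v \<in> ?S"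
      using AE_in_set_eq_1[of ?S] range_mat_in_vec_borel[OF H] sets by simp
    then have AE: "AE v in \<mu>. H *\<^sub>v (K *\<^sub>v v) = v" by eventually_elim (auto simp: HK)
    have "mat_push H (mat_push K \<mu>) = distr \<mu> (vec_borel n) ((\<lambda>v. H *\<^sub>v v) \<circ> (\<lambda>v. K *\<^sub>v v))"
      unfolding mat_push_def using H K
      by (simp add: distr_distr[OF measurable_mult_mat_vec[OF H] K_meas])
    also have "\<dots> = distr \<mu> (vec_borel n) (\<lambda>v. v)"
    proof (rule distr_cong_AE)
      show "(\<lambda>v. H *\<^sub>v v) \<circ> (\<lambda>v. K *\<^sub>v v) \<in> \<mu> \<rightarrow>\<^sub>M vec_borel n"
        by (rule measurable_comp[OF K_meas measurable_mult_mat_vec[OF H]])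
      show "(\<lambda>v. v) \<in> \<mu> \<rightarrow>\<^sub>M vec_borel n" by (rule measurable_ident_sets[OF sets])
    qed (use AE in auto)
    also have "\<dots> = \<mu>" using sets by (simp add: distr_id2)
    finally have "\<mu> = mat_push H (mat_push K \<mu>)" by simp
    then show "\<mu> \<in> {mat_push H \<nu> | \<nu>. \<nu> \<in> vec_probs m}"
      using push_prob[OF K] \<mu> by (auto simp: vec_probs_on_def)
  }
qed

section \<open>Hankel matrices and persistency of excitation\<close>

text \<open>
  With full row rank the columns span the whole space; then \<open>a\<close> is orthogonal to itself.
\<close>

lemma full_row_rank_annihilator:
  assumes H: "(H :: rmat) \<in> carrier_mat n m" and rank: "vec_space.rank n H = n"
    and a: "a \<in> carrier_vec n" and orth: "\<And>j. j < m \<Longrightarrow> a \<bullet> col H j = 0"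
  shows "a = 0\<^sub>v n"
proof -
  interpret vec_space "TYPE(real)" n .
  have "\<exists>U. maximal U (\<lambda>T. T \<subseteq> set (cols H) \<and> lin_indpt T)"
    using maximal_exists_superset[of "set (cols H)" "\<lambda>T. T \<subseteq> set (cols H) \<and> lin_indpt T" "{}"]
    by (auto simp: lin_dep_def)
  then obtain U where U: "maximal U (\<lambda>T. T \<subseteq> set (cols H) \<and> lin_indpt T)" by blast
  then have sub: "U \<subseteq> set (cols H)" and li: "lin_indpt U" by (auto simp: maximal_def)
  have cols: "set (cols H) \<subseteq> carrier_vec n" using H cols_dim by blast
  have "card U = n" using rank_card_indpt[OF H U] rank by simp
  then have "basis U"
    using sub li cols by (intro dim_li_is_basis) (auto simp: dim_is_n intro: finite_subset)
  then have "a \<in> span U" using a by (auto simp: basis_def)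
  moreover have "submodule class_ring {v \<in> carrier_vec n. a \<bullet> v = 0} V"
    using a by unfold_locales (auto simp: scalar_prod_add_distrib[of _ n] class_ring_simps)
  moreover have "U \<subseteq> {v \<in> carrier_vec n. a \<bullet> v = 0}"
    using sub cols orth H by (auto simp: cols_def)
  ultimately have "a \<bullet> a = 0" using span_is_subset by blast
  then show ?thesis
    using a by (simp add: scalar_prod_self_eq_0)
qed

lemma dim_window [simp]: "dim_vec (window q L w j) = L * q"
  by (simp add: window_def)

lemma scalar_prod_window:
  assumes a: "a \<in> carrier_vec (L * q)"
  shows "a \<bullet> window q L w j = (\<Sum>k<L. \<Sum>l<q. a $ (k * q + l) * w (j + k) $ l)"
proof (cases "q = 0")
  case False
  have "a \<bullet> window q L w j = (\<Sum>i<L * q. a $ i * w (j + i div q) $ (i mod q))"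
    by (simp add: scalar_prod_def window_def lessThan_atLeast0)
  also have "\<dots> = (\<Sum>k<L. \<Sum>i\<in>{k * q..<k * q + q}. a $ i * w (j + i div q) $ (i mod q))"
    by (rule sum.nat_group[symmetric])
  also have "\<dots> = (\<Sum>k<L. \<Sum>l<q. a $ (k * q + l) * w (j + k) $ l)"
  proof (rule sum.cong)
    fix k
    have "(\<Sum>i\<in>{k * q..<k * q + q}. a $ i * w (j + i div q) $ (i mod q))
        = (\<Sum>l\<in>{0..<q}. a $ (l + k * q) * w (j + (l + k * q) div q) $ ((l + k * q) mod q))"
      using sum.shift_bounds_nat_ivl[of "\<lambda>i. a $ i * w (j + i div q) $ (i mod q)" 0 "k * q" q]
      by (simp add: add.commute)
    also have "\<dots> = (\<Sum>l<q. a $ (k * q + l) * w (j + k) $ l)"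
      using False by (intro sum.cong) (auto simp: add.commute)
    finally show "(\<Sum>i\<in>{k * q..<k * q + q}. a $ i * w (j + i div q) $ (i mod q))
        = (\<Sum>l<q. a $ (k * q + l) * w (j + k) $ l)" .
  qed simp
  finally show ?thesis .
next
  case True
  have "dim_vec (window q L w j) = 0" using True by simp
  then show ?thesis unfolding scalar_prod_def using True by simp
qed

lemma hankel_carrier: "hankel q L N w \<in> carrier_mat (L * q) (N + 1 - L)"
  unfolding hankel_def by (rule carrier_matI) simp_all

lemma col_hankel: "j < N + 1 - L \<Longrightarrow> col (hankel q L N w) j = window q L w j"
  by (simp add: hankel_def nth_map_upt carrier_vecI)

text \<open>
  The only form in which persistency of excitation enters: the shifted inputs satisfy no
  nontrivial linear relation over \<open>K\<close> consecutive time steps.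
\<close>

lemma persistently_exciting_annihilator:
  assumes pe: "persistently_exciting nu N u K"
    and ann: "\<And>j. j + K \<le> N \<Longrightarrow> (\<Sum>t<K. \<Sum>i<nu. f t i * u (j + t) $ i) = 0"
    and "t < K" "i < nu"
  shows "f t i = 0"
proof -
  define a where "a = Matrix.vec (K * nu) (\<lambda>l. f (l div nu) (l mod nu))"
  have index: "k * nu + l < K * nu" if "k < K" "l < nu" for k l
  proof -
    have "Suc k * nu \<le> K * nu" using that by (intro mult_le_mono1) auto
    then show ?thesis using that by simp
  qed
  have a: "a \<in> carrier_vec (K * nu)" by (simp add: a_def)
  have a_index: "a $ (k * nu + l) = f k l" if "k < K" "l < nu" for k l
    using that index[OF that] by (simp add: a_def)
  have "a = 0\<^sub>v (K * nu)"
  proof (rule full_row_rank_annihilator[OF hankel_carrier])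
    show "vec_space.rank (K * nu) (hankel nu K N u) = K * nu"
      using pe by (simp add: persistently_exciting_def)
    fix j assume j: "j < N + 1 - K"
    have "a \<bullet> window nu K u j = (\<Sum>t<K. \<Sum>i<nu. f t i * u (j + t) $ i)"
      by (subst scalar_prod_window[OF a]) (simp add: a_index)
    also have "\<dots> = 0" using j by (intro ann) simp
    finally show "a \<bullet> col (hankel nu K N u) j = 0" using j by (simp add: col_hankel)
  qed (rule a)
  then show ?thesis using a_index[OF assms(3,4)] index[OF assms(3,4)] by simp
qed

section \<open>Controllability\<close>

lemma pow_mat_vec_carrier: "A \<in> carrier_mat n n \<Longrightarrow> A ^\<^sub>m k *\<^sub>v x \<in> carrier_vec n"
  by (intro carrier_vecI) simp

lemma pow_mat_vec_Suc:
  assumes "A \<in> carrier_mat n n" "(x :: rvec) \<in> carrier_vec n"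
  shows "A ^\<^sub>m Suc k *\<^sub>v x = A ^\<^sub>m k *\<^sub>v (A *\<^sub>v x)"
  using assms by (simp add: assoc_mult_mat_vec[of _ n n _ n])

lemma pow_mat_vec_add:
  assumes "A \<in> carrier_mat n n" "(x :: rvec) \<in> carrier_vec n"
  shows "A ^\<^sub>m (j + k) *\<^sub>v x = A ^\<^sub>m j *\<^sub>v (A ^\<^sub>m k *\<^sub>v x)"
  using assms(2)
proof (induction k arbitrary: x)
  case (Suc k)
  then show ?case
    using assms(1) Suc.IH[of "A *\<^sub>v x"] by (simp add: pow_mat_vec_Suc del: pow_mat.simps(2))
qed (use assms(1) in simp)

lemma scalar_prod_pow_mat_input:
  assumes A: "A \<in> carrier_mat n n" and B: "B \<in> carrier_mat n m"
    and p: "(p :: rvec) \<in> carrier_vec n" and u: "u \<in> carrier_vec m"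
  shows "p \<bullet> (A ^\<^sub>m k *\<^sub>v (B *\<^sub>v u)) = (\<Sum>i<m. u $ i * (p \<bullet> (A ^\<^sub>m k *\<^sub>v col B i)))"
proof -
  have "p \<bullet> (A ^\<^sub>m k *\<^sub>v (B *\<^sub>v u)) = p \<bullet> ((A ^\<^sub>m k * B) *\<^sub>v u)"
    using assms by (simp add: assoc_mult_mat_vec[of _ n n _ m])
  also have "\<dots> = (\<Sum>i<m. u $ i * (p \<bullet> col (A ^\<^sub>m k * B) i))"
    using assms by (intro scalar_prod_mult_mat_vec[of _ n]) auto
  also have "\<dots> = (\<Sum>i<m. u $ i * (p \<bullet> (A ^\<^sub>m k *\<^sub>v col B i)))"
    using A B by (intro sum.cong) (auto simp: col_mult2[of _ n n _ m] simp del: col_mult)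
  finally show ?thesis .
qed

text \<open>
  A functional that vanishes on all \<open>A\<^sup>k B\<close> vanishes, together with its compositions with the
  powers of \<open>A\<close>, along every trajectory starting at the origin; one of these trajectories ends at \<open>p\<close>.
\<close>

lemma controllable_annihilator:
  assumes A: "A \<in> carrier_mat nx nx" and B: "B \<in> carrier_mat nx nu"
    and ctrl: "controllable nx nu A B" and p: "p \<in> carrier_vec nx"
    and zero: "\<And>k i. i < nu \<Longrightarrow> p \<bullet> (A ^\<^sub>m k *\<^sub>v col B i) = 0"
  shows "p = 0\<^sub>v nx"
proof -
  from ctrl[unfolded controllable_def, rule_format, OF zero_carrier_vec p]
  obtain T and u x :: "nat \<Rightarrow> rvec" where traj: "\<forall>t<T. u t \<in> carrier_vec nu" "x 0 = 0\<^sub>v nx"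
      "\<forall>t<T. x (Suc t) = A *\<^sub>v x t + B *\<^sub>v u t" "x T = p"
    by (elim exE conjE)
  note u = traj(1)[rule_format] and x0 = traj(2) and step = traj(3)[rule_format] and xT = traj(4)
  have "x t \<in> carrier_vec nx \<and> (\<forall>k. p \<bullet> (A ^\<^sub>m k *\<^sub>v x t) = 0)" if "t \<le> T" for t
    using that
  proof (induction t)
    case 0
    have "A ^\<^sub>m k *\<^sub>v 0\<^sub>v nx = 0\<^sub>v nx" for k using A by (intro eq_vecI) auto
    then show ?case using p x0 by simp
  next
    case (Suc t)
    then have t: "t < T" and xt: "x t \<in> carrier_vec nx"
      and IH: "\<And>k. p \<bullet> (A ^\<^sub>m k *\<^sub>v x t) = 0" by auto
    have "p \<bullet> (A ^\<^sub>m k *\<^sub>v x (Suc t)) = 0" for k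
    proof -
      have "A ^\<^sub>m k *\<^sub>v x (Suc t) = A ^\<^sub>m Suc k *\<^sub>v x t + A ^\<^sub>m k *\<^sub>v (B *\<^sub>v u t)"
        using A B u[OF t] xt
        by (simp add: step[OF t] pow_mat_vec_Suc mult_add_distrib_mat_vec[of _ nx nx] del: pow_mat.simps(2))
      moreover have "p \<bullet> (A ^\<^sub>m k *\<^sub>v (B *\<^sub>v u t)) = 0"
        using scalar_prod_pow_mat_input[OF A B p u[OF t]] zero by simp
      ultimately show ?thesis
        using IH[of "Suc k"] p A B u[OF t] xt
        by (simp add: scalar_prod_add_distrib[of _ nx] pow_mat_vec_carrier del: pow_mat.simps(2))
    qed
    then show ?case using A B u[OF t] xt by (simp add: step[OF t])
  qed
  from this[of T] have "p \<bullet> (A ^\<^sub>m 0 *\<^sub>v p) = 0" using xT by blast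
  then show ?thesis using p A by (simp add: scalar_prod_self_eq_0)
qed

section \<open>Annihilating polynomials from the transfer function\<close>

text \<open>
  The polynomial \<open>r adj(zI - A) b\<close>, that is, the numerator of \<open>r (zI - A)\<^sup>-\<^sup>1 b\<close> over the
  denominator \<open>char_poly A\<close>.
\<close>

definition adj_form :: "rmat \<Rightarrow> rvec \<Rightarrow> rvec \<Rightarrow> real poly" where
  "adj_form A r b = (\<Sum>k<dim_row A. \<Sum>l<dim_row A.
     Polynomial.smult (r $ k * b $ l) (adj_mat (char_poly_matrix A) $$ (k, l)))"

lemma smult_sum_right: "Polynomial.smult c (\<Sum>i\<in>I. f i) = (\<Sum>i\<in>I. Polynomial.smult c (f i))"
  by (induction I rule: infinite_finite_induct) (simp_all add: smult_add_right)

lemma adj_form_sum_right: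
  assumes "A \<in> carrier_mat n n"
  shows "(\<Sum>i\<in>I. Polynomial.smult (c i) (adj_form A r (b i))) = adj_form A r (Matrix.vec n (\<lambda>l. \<Sum>i\<in>I. c i * b i $ l))"
proof -
  have "(\<Sum>i\<in>I. Polynomial.smult (c i) (adj_form A r (b i)))
      = (\<Sum>i\<in>I. \<Sum>k<n. \<Sum>l<n. Polynomial.smult (c i * (r $ k * b i $ l)) (adj_mat (char_poly_matrix A) $$ (k, l)))"
    using assms by (simp add: adj_form_def smult_sum_right)
  also have "\<dots> = (\<Sum>k<n. \<Sum>l<n. \<Sum>i\<in>I. Polynomial.smult (c i * (r $ k * b i $ l)) (adj_mat (char_poly_matrix A) $$ (k, l)))"
    by (subst sum.swap, intro sum.cong[OF refl], rule sum.swap)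
  also have "\<dots> = adj_form A r (Matrix.vec n (\<lambda>l. \<Sum>i\<in>I. c i * b i $ l))"
    using assms by (simp add: adj_form_def sum_distrib_left smult_sum mult_ac)
  finally show ?thesis .
qed

text \<open>
  The identity \<open>adj(zI - A) (zI - A) = \<chi> I\<close>, read as: multiplication by \<open>z\<close> acts on the numerators
  modulo \<open>\<chi>\<close> like \<open>A\<close> on the vector \<open>b\<close>.
\<close>

lemma adj_form_shift:
  assumes A: "A \<in> carrier_mat n n" and r: "r \<in> carrier_vec n" and b: "b \<in> carrier_vec n"
  shows "[:0, 1:] * adj_form A r b = Polynomial.smult (r \<bullet> b) (char_poly A) + adj_form A r (A *\<^sub>v b)"
proof -
  define P where "P = char_poly_matrix A"
  define J where "J = adj_mat P"
  have P: "P \<in> carrier_mat n n" using A by (simp add: P_def)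
  have J: "J \<in> carrier_mat n n" and JP: "J * P = char_poly A \<cdot>\<^sub>m 1\<^sub>m n"
    using adj_mat[OF P] by (auto simp: J_def P_def char_poly_def)
  have entry: "[:0, 1:] * J $$ (k, l) = (if k = l then char_poly A else 0)
      + (\<Sum>m<n. Polynomial.smult (A $$ (m, l)) (J $$ (k, m)))" if "k < n" "l < n" for k l
  proof -
    have "(J * P) $$ (k, l) = (\<Sum>m<n. J $$ (k, m) * P $$ (m, l))"
      using that J P by (simp add: scalar_prod_def lessThan_atLeast0)
    also have "\<dots> = (\<Sum>m<n. (if m = l then [:0, 1:] * J $$ (k, l) else 0) - Polynomial.smult (A $$ (m, l)) (J $$ (k, m)))"
      using that A by (intro sum.cong) (auto simp: P_def char_poly_matrix_def algebra_simps)
    also have "\<dots> = [:0, 1:] * J $$ (k, l) - (\<Sum>m<n. Polynomial.smult (A $$ (m, l)) (J $$ (k, m)))"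
      using that by (simp add: sum_subtractf)
    finally show ?thesis using that unfolding JP by (simp add: algebra_simps split: if_splits)
  qed
  have "[:0, 1:] * adj_form A r b = (\<Sum>k<n. \<Sum>l<n. Polynomial.smult (r $ k * b $ l) ([:0, 1:] * J $$ (k, l)))"
    using A by (simp only: adj_form_def sum_distrib_left mult_smult_right J_def P_def carrier_matD)
  also have "\<dots> = (\<Sum>k<n. \<Sum>l<n. Polynomial.smult (r $ k * b $ l) (if k = l then char_poly A else 0))
      + (\<Sum>k<n. \<Sum>l<n. \<Sum>m<n. Polynomial.smult (r $ k * b $ l * A $$ (m, l)) (J $$ (k, m)))"
  proof -
    have "Polynomial.smult (r $ k * b $ l) ([:0, 1:] * J $$ (k, l))
        = Polynomial.smult (r $ k * b $ l) (if k = l then char_poly A else 0)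
          + (\<Sum>m<n. Polynomial.smult (r $ k * b $ l * A $$ (m, l)) (J $$ (k, m)))"
      if "k < n" "l < n" for k l
      unfolding entry[OF that] by (simp only: smult_add_right smult_sum_right smult_smult)
    then show ?thesis by (simp only: sum.distrib[symmetric]) (intro sum.cong refl, auto)
  qed
  also have "(\<Sum>k<n. \<Sum>l<n. Polynomial.smult (r $ k * b $ l) (if k = l then char_poly A else 0))
      = Polynomial.smult (r \<bullet> b) (char_poly A)"
  proof -
    have "(\<Sum>l<n. Polynomial.smult (r $ k * b $ l) (if k = l then char_poly A else 0))
        = Polynomial.smult (r $ k * b $ k) (char_poly A)" if "k < n" for k
    proof -
      have "(\<Sum>l<n. Polynomial.smult (r $ k * b $ l) (if k = l then char_poly A else 0))
          = (\<Sum>l<n. if k = l then Polynomial.smult (r $ k * b $ l) (char_poly A) else 0)"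
        by (intro sum.cong) auto
      then show ?thesis using that by simp
    qed
    then have "(\<Sum>k<n. \<Sum>l<n. Polynomial.smult (r $ k * b $ l) (if k = l then char_poly A else 0))
        = (\<Sum>k<n. Polynomial.smult (r $ k * b $ k) (char_poly A))"
      by (intro sum.cong) auto
    also have "\<dots> = Polynomial.smult (\<Sum>k<n. r $ k * b $ k) (char_poly A)" by (rule smult_sum[symmetric])
    also have "(\<Sum>k<n. r $ k * b $ k) = r \<bullet> b"
      using b by (simp add: scalar_prod_def lessThan_atLeast0)
    finally show ?thesis .
  qed
  also have "(\<Sum>k<n. \<Sum>l<n. \<Sum>m<n. Polynomial.smult (r $ k * b $ l * A $$ (m, l)) (J $$ (k, m)))
      = (\<Sum>k<n. \<Sum>m<n. \<Sum>l<n. Polynomial.smult (r $ k * b $ l * A $$ (m, l)) (J $$ (k, m)))"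
    by (intro sum.cong[OF refl] sum.swap)
  also have "\<dots> = adj_form A r (A *\<^sub>v b)"
    using A b by (simp add: adj_form_def J_def P_def scalar_prod_def lessThan_atLeast0
        sum_distrib_left smult_sum mult_ac)
  finally show ?thesis .
qed

text \<open>
  Strict properness: the entries of the adjugate are minors of size \<open>n - 1\<close> with entries of degree
  at most one, so their degree is below that of \<open>\<chi>\<close>.
\<close>

lemma adj_form_eq_0_if_dvd:
  assumes A: "A \<in> carrier_mat n n" and dvd: "char_poly A dvd adj_form A r b"
  shows "adj_form A r b = 0"
proof (cases "n = 0")
  case True
  then show ?thesis using A by (simp add: adj_form_def)
next
  case False
  have "degree (adj_mat (char_poly_matrix A) $$ (k, l)) \<le> n - 1" if "k < n" "l < n" for k l
  proof -
    have "degree (det (mat_delete (char_poly_matrix A) l k)) \<le> 1 * (n - 1)"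
    proof (rule degree_det_le)
      show "mat_delete (char_poly_matrix A) l k \<in> carrier_mat (n - 1) (n - 1)"
        using A by (intro mat_delete_carrier) simp
      fix i j assume "i < n - 1" "j < n - 1"
      then show "degree (mat_delete (char_poly_matrix A) l k $$ (i, j)) \<le> 1"
        using A by (auto simp: mat_delete_def char_poly_matrix_def intro!: degree_add_le)
    qed
    moreover have "adj_mat (char_poly_matrix A) $$ (k, l)
        = (- 1) ^ (l + k) * det (mat_delete (char_poly_matrix A) l k)"
      using that carrier_matD[OF char_poly_matrix_closed[OF A]] by (simp add: adj_mat_def cofactor_def)
    ultimately show ?thesis by (cases "even (l + k)") simp_all
  qed
  then have "degree (adj_form A r b) \<le> n - 1"
    using A unfolding adj_form_def
    by (intro degree_sum_le) (auto intro: order_trans[OF degree_smult_le])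
  then show ?thesis
    using False dvd_imp_degree_le[OF dvd] degree_monic_char_poly[OF A] by fastforce
qed

lemma adj_form_eq_0_step:
  assumes A: "A \<in> carrier_mat n n" and r: "r \<in> carrier_vec n" and b: "b \<in> carrier_vec n"
    and zero: "adj_form A r b = 0"
  shows "r \<bullet> b = 0" and "adj_form A r (A *\<^sub>v b) = 0"
proof -
  have shift: "0 = Polynomial.smult (r \<bullet> b) (char_poly A) + adj_form A r (A *\<^sub>v b)"
    using adj_form_shift[OF A r b] zero by simp
  then have "adj_form A r (A *\<^sub>v b) = Polynomial.smult (- (r \<bullet> b)) (char_poly A)"
    by (simp add: eq_neg_iff_add_eq_0 add.commute)
  then show next0: "adj_form A r (A *\<^sub>v b) = 0"
    by (intro adj_form_eq_0_if_dvd[OF A]) (simp add: dvd_smult)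
  have "char_poly A \<noteq> 0" using degree_monic_char_poly[OF A] by auto
  then show "r \<bullet> b = 0" using shift next0 by simp
qed

text \<open>
  If the rational function \<open>r (zI - A)\<^sup>-\<^sup>1 b\<close> is zero, so are the coefficients \<open>r A\<^sup>k b\<close>
  of its expansion at infinity; \<open>adj_form_eq_0_step\<close> peels them off one by one.
\<close>

lemma adj_form_eq_0_imp_orthogonal:
  assumes A: "A \<in> carrier_mat n n" and r: "r \<in> carrier_vec n" and b: "b \<in> carrier_vec n"
    and zero: "adj_form A r b = 0"
  shows "r \<bullet> (A ^\<^sub>m k *\<^sub>v b) = 0"
  using b zero
proof (induction k arbitrary: b)
  case (0 b)
  then show ?case using adj_form_eq_0_step(1)[OF A r] A by simp
next
  case (Suc k b)
  then show ?case
    using adj_form_eq_0_step(2)[OF A r Suc.prems] A by (simp add: pow_mat_vec_Suc del: pow_mat.simps(2))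
qed

lemma char_poly_dvd_adj_form_diff:
  assumes A: "A \<in> carrier_mat n n" and r: "r \<in> carrier_vec n" and b: "b \<in> carrier_vec n"
  shows "char_poly A dvd c * adj_form A r b
           - (\<Sum>k\<le>degree c. Polynomial.smult (coeff c k) (adj_form A r (A ^\<^sub>m k *\<^sub>v b)))"
proof -
  have power: "char_poly A dvd monom 1 k * adj_form A r b - adj_form A r (A ^\<^sub>m k *\<^sub>v b)" for k
    using b
  proof (induction k arbitrary: b)
    case (0 b)
    then show ?case using A by (simp add: monom_0 one_pCons[symmetric])
  next
    case (Suc k b)
    have "monom 1 (Suc k) * adj_form A r b = monom 1 k * ([:0, 1:] * adj_form A r b)"
      by (simp add: monom_Suc)
    also have "\<dots> = char_poly A * Polynomial.smult (r \<bullet> b) (monom 1 k) + monom 1 k * adj_form A r (A *\<^sub>v b)"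
      unfolding adj_form_shift[OF A r Suc.prems] by (simp add: algebra_simps)
    finally have "monom 1 (Suc k) * adj_form A r b - adj_form A r (A ^\<^sub>m Suc k *\<^sub>v b)
        = char_poly A * Polynomial.smult (r \<bullet> b) (monom 1 k)
          + (monom 1 k * adj_form A r (A *\<^sub>v b) - adj_form A r (A ^\<^sub>m k *\<^sub>v (A *\<^sub>v b)))"
      using A Suc.prems by (simp add: pow_mat_vec_Suc del: pow_mat.simps(2))
    then show ?case using Suc.IH[OF mult_mat_vec_carrier[OF A Suc.prems]] by (auto intro!: dvd_add dvd_smult)
  qed
  have "c * adj_form A r b = (\<Sum>k\<le>degree c. monom (coeff c k) k) * adj_form A r b"
    by (simp only: poly_as_sum_of_monoms)
  also have "\<dots> = (\<Sum>k\<le>degree c. Polynomial.smult (coeff c k) (monom 1 k * adj_form A r b))"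
    by (simp add: sum_distrib_right smult_monom flip: mult_smult_left)
  finally have "c * adj_form A r b - (\<Sum>k\<le>degree c. Polynomial.smult (coeff c k) (adj_form A r (A ^\<^sub>m k *\<^sub>v b)))
      = (\<Sum>k\<le>degree c. Polynomial.smult (coeff c k) (monom 1 k * adj_form A r b - adj_form A r (A ^\<^sub>m k *\<^sub>v b)))"
    by (simp add: sum_subtractf smult_diff_right)
  then show ?thesis using power by (auto intro!: dvd_sum dvd_smult)
qed

lemma transfer_function_entry:
  assumes sys: "lti_system nx nu ny A B C D" and i: "i < ny" and j: "j < nu"
  shows "to_fract (char_poly A) * transfer_function A B C D $$ (i, j)
       = to_fract (Polynomial.smult (D $$ (i, j)) (char_poly A) + adj_form A (row C i) (col B j))"
proof -
  have A: "A \<in> carrier_mat nx nx" and B: "B \<in> carrier_mat nx nu"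
    and C: "C \<in> carrier_mat ny nx" and D: "D \<in> carrier_mat ny nu"
    using sys by (auto simp: lti_system_def)
  define P where "P = char_poly_matrix A"
  define J where "J = adj_mat P"
  have P: "P \<in> carrier_mat nx nx" using A by (simp add: P_def)
  have J: "J \<in> carrier_mat nx nx" and PJ: "P * J = char_poly A \<cdot>\<^sub>m 1\<^sub>m nx"
    using adj_mat[OF P] by (auto simp: J_def P_def char_poly_def)
  interpret to_fract: comm_ring_hom "to_fract :: real poly \<Rightarrow> real poly fract"
    by unfold_locales auto
  define X where "X = map_mat to_fract P"
  define F where "F = map_mat to_fract J"
  have X: "X \<in> carrier_mat nx nx" and F: "F \<in> carrier_mat nx nx" using P J by (auto simp: X_def F_def)
  have XF: "X * F = to_fract (char_poly A) \<cdot>\<^sub>m 1\<^sub>m nx"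
  proof -
    have "X * F = map_mat to_fract (char_poly A \<cdot>\<^sub>m 1\<^sub>m nx)"
      using to_fract.mat_hom_mult[OF P J] by (simp add: X_def F_def PJ)
    also have "\<dots> = to_fract (char_poly A) \<cdot>\<^sub>m 1\<^sub>m nx" by (intro eq_matI) auto
    finally show ?thesis .
  qed
  have nonzero: "to_fract (char_poly A) \<noteq> 0" using degree_monic_char_poly[OF A] by auto
  have inverse_exists: "mat_inverse X \<noteq> None"
  proof
    assume "mat_inverse X = None"
    then have "X \<notin> Units (ring_mat TYPE(real poly fract) nx ())" by (rule mat_inverse(1)[OF X])
    moreover have "det X \<noteq> 0"
      using to_fract.hom_det[of P] nonzero by (simp add: X_def P_def char_poly_def)
    ultimately show False using det_non_zero_imp_unit[OF X, where b = "()"] by blast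
  qed
  define Y where "Y = the (mat_inverse X)"
  have YX: "Y * X = 1\<^sub>m nx" and Y: "Y \<in> carrier_mat nx nx"
    using mat_inverse(2)[OF X, of Y] inverse_exists by (auto simp: Y_def)
  have "F = (Y * X) * F" using F by (simp add: YX)
  also have "\<dots> = Y * (X * F)" using X Y F by (intro assoc_mult_mat)
  also have "\<dots> = to_fract (char_poly A) \<cdot>\<^sub>m Y" unfolding XF mult_smult_distrib[OF Y one_carrier_mat] using Y by simp
  finally have "F $$ (k, l) = to_fract (char_poly A) * Y $$ (k, l)" if "k < nx" "l < nx" for k l
    using that Y by simp
  then have Y_entry: "to_fract (char_poly A) * Y $$ (k, l) = to_fract (J $$ (k, l))"
    if "k < nx" "l < nx" for k l using that J by (simp add: F_def)
  have G: "transfer_function A B C D $$ (i, j)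
      = to_fract [:D $$ (i, j):] + (\<Sum>l<nx. (\<Sum>k<nx. to_fract [:C $$ (i, k):] * Y $$ (k, l)) * to_fract [:B $$ (l, j):])"
  proof -
    have "transfer_function A B C D $$ (i, j)
        = to_fract [:D $$ (i, j):] + (\<Sum>k<nx. to_fract [:C $$ (i, k):] * (\<Sum>l<nx. Y $$ (k, l) * to_fract [:B $$ (l, j):]))"
      using A B C D Y i j
      by (simp add: transfer_function_def const_mat_def scalar_prod_def lessThan_atLeast0
          flip: P_def X_def Y_def)
    also have "(\<Sum>k<nx. to_fract [:C $$ (i, k):] * (\<Sum>l<nx. Y $$ (k, l) * to_fract [:B $$ (l, j):]))
        = (\<Sum>l<nx. (\<Sum>k<nx. to_fract [:C $$ (i, k):] * Y $$ (k, l)) * to_fract [:B $$ (l, j):])"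
      unfolding sum_distrib_left sum_distrib_right mult.assoc by (rule sum.swap)
    finally show ?thesis .
  qed
  have summand: "to_fract (char_poly A) * (to_fract [:C $$ (i, k):] * Y $$ (k, l) * to_fract [:B $$ (l, j):])
      = to_fract (Polynomial.smult (C $$ (i, k) * B $$ (l, j)) (J $$ (k, l)))" if "l < nx" "k < nx" for k l
  proof -
    have "to_fract (char_poly A) * (to_fract [:C $$ (i, k):] * Y $$ (k, l) * to_fract [:B $$ (l, j):])
        = to_fract (char_poly A) * Y $$ (k, l) * (to_fract [:C $$ (i, k):] * to_fract [:B $$ (l, j):])"
      by (simp only: mult.assoc mult.left_commute)
    also have "\<dots> = to_fract (J $$ (k, l) * ([:C $$ (i, k):] * [:B $$ (l, j):]))"
      by (simp only: Y_entry[OF that(2,1)] to_fract_mult)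
    also have "J $$ (k, l) * ([:C $$ (i, k):] * [:B $$ (l, j):])
        = Polynomial.smult (C $$ (i, k) * B $$ (l, j)) (J $$ (k, l))"
      by (simp add: mult.commute)
    finally show ?thesis .
  qed
  have feedthrough: "to_fract (char_poly A) * to_fract [:D $$ (i, j):]
      = to_fract (Polynomial.smult (D $$ (i, j)) (char_poly A))"
    unfolding to_fract_mult[symmetric] by simp
  have "to_fract (char_poly A) * transfer_function A B C D $$ (i, j)
      = to_fract (Polynomial.smult (D $$ (i, j)) (char_poly A)) + (\<Sum>l<nx. \<Sum>k<nx.
          to_fract (char_poly A) * (to_fract [:C $$ (i, k):] * Y $$ (k, l) * to_fract [:B $$ (l, j):]))"
    by (simp only: G distrib_left sum_distrib_left sum_distrib_right feedthrough)
  also have "\<dots> = to_fract (Polynomial.smult (D $$ (i, j)) (char_poly A)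
      + (\<Sum>l<nx. \<Sum>k<nx. Polynomial.smult (C $$ (i, k) * B $$ (l, j)) (J $$ (k, l))))"
    by (simp add: summand)
  also have "(\<Sum>l<nx. \<Sum>k<nx. Polynomial.smult (C $$ (i, k) * B $$ (l, j)) (J $$ (k, l)))
      = (\<Sum>k<nx. \<Sum>l<nx. Polynomial.smult (C $$ (i, k) * B $$ (l, j)) (J $$ (k, l)))"
    by (rule sum.swap)
  also have "\<dots> = adj_form A (row C i) (col B j)"
    using A B C i j by (simp add: adj_form_def J_def P_def)
  finally show ?thesis .
qed

text \<open>
  The matrix identity \<open>C c(A) = 0\<close>, stated row by row and evaluated at \<open>x\<close>. It compares
  \<open>C (zI - A)\<^sup>-\<^sup>1 B\<close> and \<open>C' (zI - A')\<^sup>-\<^sup>1 B'\<close>, which differ by the constant \<open>D' - D\<close>: modulo \<open>char_poly A\<close>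
  the numerator of the first times \<open>c\<close> is zero, and it is also the numerator
  of \<open>C c(A) (zI - A)\<^sup>-\<^sup>1 B\<close>.
\<close>

lemma transfer_function_annihilating_poly:
  assumes sys: "lti_system nx nu ny A B C D" and sys': "lti_system n nu ny A' B' C' D'"
    and ctrl: "controllable nx nu A B"
    and same: "transfer_function A B C D = transfer_function A' B' C' D'"
    and dvd: "char_poly A' dvd c" and i: "i < ny" and x: "x \<in> carrier_vec nx"
  shows "(\<Sum>k\<le>degree c. coeff c k * (row C i \<bullet> (A ^\<^sub>m k *\<^sub>v x))) = 0"
proof -
  have A: "A \<in> carrier_mat nx nx" and B: "B \<in> carrier_mat nx nu" and C: "C \<in> carrier_mat ny nx"
    using sys by (auto simp: lti_system_def)
  define r where "r = row C i"
  have r: "r \<in> carrier_vec nx" using C i by (auto simp: r_def)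
  \<comment> \<open>The row vector \<open>r c(A)\<close>.\<close>
  define p where "p = Matrix.vec nx (\<lambda>l. \<Sum>k\<le>degree c. coeff c k * (r \<bullet> col (A ^\<^sub>m k) l))"
  have p: "p \<in> carrier_vec nx" by (simp add: p_def)
  have p_apply: "p \<bullet> z = (\<Sum>k\<le>degree c. coeff c k * (r \<bullet> (A ^\<^sub>m k *\<^sub>v z)))" if z: "z \<in> carrier_vec nx" for z
  proof -
    have "(\<Sum>k\<le>degree c. coeff c k * (r \<bullet> (A ^\<^sub>m k *\<^sub>v z)))
        = (\<Sum>k\<le>degree c. \<Sum>l<nx. coeff c k * (z $ l * (r \<bullet> col (A ^\<^sub>m k) l)))"
      using A z r by (simp add: scalar_prod_mult_mat_vec[of _ nx nx] sum_distrib_left)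
    also have "\<dots> = (\<Sum>l<nx. \<Sum>k\<le>degree c. coeff c k * (z $ l * (r \<bullet> col (A ^\<^sub>m k) l)))"
      by (rule sum.swap)
    also have "\<dots> = p \<bullet> z"
      using z by (simp add: p_def scalar_prod_def[of "Matrix.vec _ _"] lessThan_atLeast0 sum_distrib_left sum_distrib_right mult_ac)
    finally show ?thesis ..
  qed
  have "p \<bullet> (A ^\<^sub>m j *\<^sub>v col B m) = 0" if m: "m < nu" for j m
  proof -
    define b where "b = col B m"
    have b: "b \<in> carrier_vec nx" using B m by (auto simp: b_def)
    \<comment> \<open>The vector \<open>c(A) b\<close>. The polynomial \<open>c\<close> acts on \<open>b\<close> here because
      \<open>adj_form_shift\<close> moves \<open>z\<close> to the right argument; commuting powers of \<open>A\<close> brings it back to \<open>r\<close>.\<close>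
    define b' where "b' = Matrix.vec nx (\<lambda>l. \<Sum>k\<le>degree c. coeff c k * (A ^\<^sub>m k *\<^sub>v b) $ l)"
    have b': "b' \<in> carrier_vec nx" by (simp add: b'_def)
    have "to_fract (char_poly A' * (Polynomial.smult (D $$ (i, m)) (char_poly A) + adj_form A r b))
        = to_fract (char_poly A') * (to_fract (char_poly A) * transfer_function A B C D $$ (i, m))"
      by (simp only: to_fract_mult transfer_function_entry[OF sys i m] r_def b_def)
    also have "\<dots> = to_fract (char_poly A) * (to_fract (char_poly A') * transfer_function A' B' C' D' $$ (i, m))"
      by (simp only: same mult.left_commute)
    also have "\<dots> = to_fract (char_poly A * (Polynomial.smult (D' $$ (i, m)) (char_poly A') + adj_form A' (row C' i) (col B' m)))"
      by (simp only: to_fract_mult transfer_function_entry[OF sys' i m])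
    finally have "char_poly A' * (Polynomial.smult (D $$ (i, m)) (char_poly A) + adj_form A r b)
        = char_poly A * (Polynomial.smult (D' $$ (i, m)) (char_poly A') + adj_form A' (row C' i) (col B' m))"
      by (simp only: to_fract_eq_iff)
    then have "char_poly A' * adj_form A r b = char_poly A *
        (Polynomial.smult (D' $$ (i, m)) (char_poly A') + adj_form A' (row C' i) (col B' m)
          - Polynomial.smult (D $$ (i, m)) (char_poly A'))"
      by (simp add: algebra_simps)
    then have "char_poly A dvd char_poly A' * adj_form A r b" by simp
    then have "char_poly A dvd c * adj_form A r b" using dvd by (meson dvd_trans mult_dvd_mono dvd_refl)
    from dvd_diff[OF this char_poly_dvd_adj_form_diff[OF A r b, of c]]
    have "char_poly A dvd (\<Sum>k\<le>degree c. Polynomial.smult (coeff c k) (adj_form A r (A ^\<^sub>m k *\<^sub>v b)))"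
      by simp
    then have "char_poly A dvd adj_form A r b'"
      by (simp only: adj_form_sum_right[OF A] b'_def)
    then have orth: "r \<bullet> (A ^\<^sub>m j *\<^sub>v b') = 0"
      by (intro adj_form_eq_0_imp_orthogonal[OF A r b'] adj_form_eq_0_if_dvd[OF A])
    have "r \<bullet> (A ^\<^sub>m j *\<^sub>v b') = (\<Sum>l<nx. (\<Sum>k\<le>degree c. coeff c k * (A ^\<^sub>m k *\<^sub>v b) $ l) * (r \<bullet> col (A ^\<^sub>m j) l))"
      using scalar_prod_mult_mat_vec[of "A ^\<^sub>m j" nx nx r b'] A r by (simp add: b'_def)
    also have "\<dots> = (\<Sum>l<nx. \<Sum>k\<le>degree c. coeff c k * ((A ^\<^sub>m k *\<^sub>v b) $ l * (r \<bullet> col (A ^\<^sub>m j) l)))"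
      by (simp add: sum_distrib_right mult.assoc)
    also have "\<dots> = (\<Sum>k\<le>degree c. \<Sum>l<nx. coeff c k * ((A ^\<^sub>m k *\<^sub>v b) $ l * (r \<bullet> col (A ^\<^sub>m j) l)))"
      by (rule sum.swap)
    also have "\<dots> = (\<Sum>k\<le>degree c. coeff c k * (r \<bullet> (A ^\<^sub>m j *\<^sub>v (A ^\<^sub>m k *\<^sub>v b))))"
    proof (intro sum.cong refl)
      fix k
      have "r \<bullet> (A ^\<^sub>m j *\<^sub>v (A ^\<^sub>m k *\<^sub>v b)) = (\<Sum>l<nx. (A ^\<^sub>m k *\<^sub>v b) $ l * (r \<bullet> col (A ^\<^sub>m j) l))"
        using A r pow_mat_vec_carrier[OF A] by (intro scalar_prod_mult_mat_vec) auto
      then show "(\<Sum>l<nx. coeff c k * ((A ^\<^sub>m k *\<^sub>v b) $ l * (r \<bullet> col (A ^\<^sub>m j) l)))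
          = coeff c k * (r \<bullet> (A ^\<^sub>m j *\<^sub>v (A ^\<^sub>m k *\<^sub>v b)))"
        by (simp only: sum_distrib_left)
    qed
    also have "\<dots> = (\<Sum>k\<le>degree c. coeff c k * (r \<bullet> (A ^\<^sub>m k *\<^sub>v (A ^\<^sub>m j *\<^sub>v b))))"
      using A b by (simp only: add.commute[of j] flip: pow_mat_vec_add)
    also have "\<dots> = p \<bullet> (A ^\<^sub>m j *\<^sub>v b)" by (simp only: p_apply[OF pow_mat_vec_carrier[OF A]])
    finally show ?thesis using orth by (simp add: b_def)
  qed
  then have "p = 0\<^sub>v nx" by (rule controllable_annihilator[OF A B ctrl p])
  then show ?thesis using p_apply[OF x] x by (simp add: r_def)
qed

section \<open>Relations satisfied by the data\<close>

definition trajectory ::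
  "nat \<Rightarrow> nat \<Rightarrow> rmat \<Rightarrow> rmat \<Rightarrow> rmat \<Rightarrow> rmat \<Rightarrow> nat
     \<Rightarrow> (nat \<Rightarrow> rvec) \<Rightarrow> (nat \<Rightarrow> rvec) \<Rightarrow> (nat \<Rightarrow> rvec) \<Rightarrow> bool" where
  "trajectory nx nu A B C D T x u y \<longleftrightarrow> x 0 \<in> carrier_vec nx \<and>
     (\<forall>t<T. u t \<in> carrier_vec nu \<and> x (Suc t) = A *\<^sub>v x t + B *\<^sub>v u t \<and> y t = C *\<^sub>v x t + D *\<^sub>v u t)"

lemma generates_iff_trajectory:
  assumes "lti_system nx nu ny A B C D"
  shows "generates nx nu ny A B C D T u y \<longleftrightarrow> (\<exists>x. trajectory nx nu A B C D T x u y)"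
proof -
  have out: "C *\<^sub>v v + D *\<^sub>v w \<in> carrier_vec ny" for v w
    using assms by (intro carrier_vecI) (auto simp: lti_system_def)
  show ?thesis
  proof
    assume "\<exists>x. trajectory nx nu A B C D T x u y"
    then obtain x where traj: "trajectory nx nu A B C D T x u y" ..
    then have "\<forall>t<T. u t \<in> carrier_vec nu \<and> y t \<in> carrier_vec ny"
      using out by (simp add: trajectory_def)
    with traj show "generates nx nu ny A B C D T u y"
      unfolding generates_def trajectory_def by (intro conjI exI[of _ x]) simp_all
  next
    assume gen: "generates nx nu ny A B C D T u y"
    then obtain x where "x 0 \<in> carrier_vec nx"
      "\<forall>t<T. x (Suc t) = A *\<^sub>v x t + B *\<^sub>v u t \<and> y t = C *\<^sub>v x t + D *\<^sub>v u t"
      unfolding generates_def by (elim conjE exE)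
    with gen have "trajectory nx nu A B C D T x u y"
      unfolding generates_def trajectory_def by simp
    then show "\<exists>x. trajectory nx nu A B C D T x u y" by (intro exI[of _ x])
  qed
qed

lemma trajectory_state_carrier:
  assumes "lti_system nx nu ny A B C D" "trajectory nx nu A B C D T x u y" "t \<le> T"
  shows "x t \<in> carrier_vec nx"
proof (cases t)
  case (Suc s)
  then show ?thesis
    using assms by (intro carrier_vecI) (auto simp: lti_system_def trajectory_def)
qed (use assms in \<open>simp add: trajectory_def\<close>)

lemma trajectory_shift:
  assumes "lti_system nx nu ny A B C D" "trajectory nx nu A B C D N x u y" "j + T \<le> N"
  shows "trajectory nx nu A B C D T (\<lambda>t. x (j + t)) (\<lambda>t. u (j + t)) (\<lambda>t. y (j + t))"
  using trajectory_state_carrier[OF assms(1,2), of j] assms(2,3) by (auto simp: trajectory_def)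

text \<open>
  Elimination of the outputs, by recursion on the first time step: the new state coefficient
  is \<open>\<beta>\<^sub>0 C + p' A\<close>. The row vectors \<open>p\<close> with \<open>p c(A) = 0\<close> contain the rows of \<open>C\<close> and are closed under
  this operation because \<open>c(A)\<close> commutes with \<open>A\<close>. The coefficients \<open>q\<close> do not depend on the
  trajectory, so the same functional can be evaluated on the data and on an arbitrary
  behavior.
\<close>

lemma observation_functional_state_form:
  fixes \<alpha> \<beta> :: "nat \<Rightarrow> nat \<Rightarrow> real"
  assumes sys: "lti_system nx nu ny A B C D"
    and ann: "\<And>i z. i < ny \<Longrightarrow> z \<in> carrier_vec nx \<Longrightarrow>
                (\<Sum>k\<le>d. c k * (row C i \<bullet> (A ^\<^sub>m k *\<^sub>v z))) = 0"
  shows "\<exists>p \<in> carrier_vec nx.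
           (\<forall>z \<in> carrier_vec nx. (\<Sum>k\<le>d. c k * (p \<bullet> (A ^\<^sub>m k *\<^sub>v z))) = 0) \<and>
           (\<exists>q. \<forall>x u y. trajectory nx nu A B C D L x u y \<longrightarrow>
              (\<Sum>k<L. (\<Sum>i<nu. \<alpha> k i * u k $ i) + (\<Sum>i<ny. \<beta> k i * y k $ i))
                = p \<bullet> x 0 + (\<Sum>k<L. \<Sum>i<nu. q k i * u k $ i))"
proof (induction L arbitrary: \<alpha> \<beta>)
  case 0
  show ?case
  proof (intro bexI[of _ "0\<^sub>v nx"] conjI exI[of _ undefined] ballI allI impI)
    fix z :: rvec assume "z \<in> carrier_vec nx"
    then show "(\<Sum>k\<le>d. c k * (0\<^sub>v nx \<bullet> (A ^\<^sub>m k *\<^sub>v z))) = 0"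
      using sys by (simp add: lti_system_def pow_mat_vec_carrier)
  qed (auto simp: trajectory_def)
next
  case (Suc L)
  have A: "A \<in> carrier_mat nx nx" and B: "B \<in> carrier_mat nx nu"
    and C: "C \<in> carrier_mat ny nx" and D: "D \<in> carrier_mat ny nu"
    using sys by (auto simp: lti_system_def)
  from Suc.IH[of "\<lambda>k. \<alpha> (Suc k)" "\<lambda>k. \<beta> (Suc k)"] obtain p' q' where p': "p' \<in> carrier_vec nx"
    and p'_ann: "\<And>z. z \<in> carrier_vec nx \<Longrightarrow> (\<Sum>k\<le>d. c k * (p' \<bullet> (A ^\<^sub>m k *\<^sub>v z))) = 0"
    and form: "\<And>x u y. trajectory nx nu A B C D L x u y \<Longrightarrow>
       (\<Sum>k<L. (\<Sum>i<nu. \<alpha> (Suc k) i * u k $ i) + (\<Sum>i<ny. \<beta> (Suc k) i * y k $ i))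
         = p' \<bullet> x 0 + (\<Sum>k<L. \<Sum>i<nu. q' k i * u k $ i)"
    by blast
  define b where "b = Matrix.vec ny (\<beta> 0)"
  have b: "b \<in> carrier_vec ny" by (simp add: b_def)
  define p where "p = C\<^sup>T *\<^sub>v b + A\<^sup>T *\<^sub>v p'"
  have Cb: "C\<^sup>T *\<^sub>v b \<in> carrier_vec nx" and Ap: "A\<^sup>T *\<^sub>v p' \<in> carrier_vec nx"
    using C A by (auto intro!: carrier_vecI)
  have p: "p \<in> carrier_vec nx" using Cb Ap by (simp add: p_def)
  have p_apply: "p \<bullet> z = b \<bullet> (C *\<^sub>v z) + p' \<bullet> (A *\<^sub>v z)" if z: "z \<in> carrier_vec nx" for z
    using z Cb Ap transpose_vec_mult_scalar[OF C z b] transpose_vec_mult_scalar[OF A z p']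
    by (simp add: p_def add_scalar_prod_distrib[of _ nx])
  define q where "q k i = (case k of 0 \<Rightarrow> \<alpha> 0 i + b \<bullet> col D i + p' \<bullet> col B i | Suc k \<Rightarrow> q' k i)" for k i
  have p_ann: "(\<Sum>k\<le>d. c k * (p \<bullet> (A ^\<^sub>m k *\<^sub>v z))) = 0" if z: "z \<in> carrier_vec nx" for z
  proof -
    have shift: "A *\<^sub>v (A ^\<^sub>m k *\<^sub>v z) = A ^\<^sub>m k *\<^sub>v (A *\<^sub>v z)" for k
      using A z pow_mat_vec_add[OF A z, of 1 k] pow_mat_vec_add[OF A z, of k 1] by (simp add: add.commute)
    have obs: "b \<bullet> (C *\<^sub>v w) = (\<Sum>i<ny. \<beta> 0 i * (row C i \<bullet> w))" for w
      using C by (simp add: scalar_prod_def[of _ "C *\<^sub>v w"] b_def lessThan_atLeast0)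
    have "(\<Sum>k\<le>d. c k * (p \<bullet> (A ^\<^sub>m k *\<^sub>v z)))
        = (\<Sum>k\<le>d. \<Sum>i<ny. c k * (\<beta> 0 i * (row C i \<bullet> (A ^\<^sub>m k *\<^sub>v z))))
          + (\<Sum>k\<le>d. c k * (p' \<bullet> (A ^\<^sub>m k *\<^sub>v (A *\<^sub>v z))))"
      using A z by (simp add: p_apply pow_mat_vec_carrier obs shift distrib_left sum.distrib sum_distrib_left)
    also have "(\<Sum>k\<le>d. c k * (p' \<bullet> (A ^\<^sub>m k *\<^sub>v (A *\<^sub>v z)))) = 0"
      using A z by (intro p'_ann) simp
    also have "(\<Sum>k\<le>d. \<Sum>i<ny. c k * (\<beta> 0 i * (row C i \<bullet> (A ^\<^sub>m k *\<^sub>v z))))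
        = (\<Sum>i<ny. \<Sum>k\<le>d. c k * (\<beta> 0 i * (row C i \<bullet> (A ^\<^sub>m k *\<^sub>v z))))"
      by (rule sum.swap)
    also have "\<dots> = (\<Sum>i<ny. \<beta> 0 i * (\<Sum>k\<le>d. c k * (row C i \<bullet> (A ^\<^sub>m k *\<^sub>v z))))"
      by (simp add: sum_distrib_left mult.left_commute)
    also have "\<dots> = 0" using z by (simp add: ann)
    finally show ?thesis by simp
  qed
  have "(\<Sum>k<Suc L. (\<Sum>i<nu. \<alpha> k i * u k $ i) + (\<Sum>i<ny. \<beta> k i * y k $ i))
      = p \<bullet> x 0 + (\<Sum>k<Suc L. \<Sum>i<nu. q k i * u k $ i)"
    if traj: "trajectory nx nu A B C D (Suc L) x u y" for x u y
  proof -
    have x0: "x 0 \<in> carrier_vec nx" and u0: "u 0 \<in> carrier_vec nu"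
      and y0: "y 0 = C *\<^sub>v x 0 + D *\<^sub>v u 0" and x1: "x (Suc 0) = A *\<^sub>v x 0 + B *\<^sub>v u 0"
      using traj by (auto simp: trajectory_def)
    have tail: "(\<Sum>k<L. (\<Sum>i<nu. \<alpha> (Suc k) i * u (Suc k) $ i) + (\<Sum>i<ny. \<beta> (Suc k) i * y (Suc k) $ i))
         = p' \<bullet> x (Suc 0) + (\<Sum>k<L. \<Sum>i<nu. q' k i * u (Suc k) $ i)"
      using form[OF trajectory_shift[OF sys traj, of 1 L]] by simp
    have "(\<Sum>i<ny. \<beta> 0 i * y 0 $ i) = b \<bullet> y 0"
      using C D by (simp add: b_def scalar_prod_def y0 lessThan_atLeast0)
    also have "\<dots> = b \<bullet> (C *\<^sub>v x 0) + (\<Sum>i<nu. u 0 $ i * (b \<bullet> col D i))"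
      unfolding y0 using C D x0 u0 b
      by (simp add: scalar_prod_add_distrib[of _ ny] scalar_prod_mult_mat_vec[of D ny nu])
    finally have out: "(\<Sum>i<ny. \<beta> 0 i * y 0 $ i) = b \<bullet> (C *\<^sub>v x 0) + (\<Sum>i<nu. u 0 $ i * (b \<bullet> col D i))" .
    have state: "p' \<bullet> x (Suc 0) = p' \<bullet> (A *\<^sub>v x 0) + (\<Sum>i<nu. u 0 $ i * (p' \<bullet> col B i))"
      unfolding x1 using A B x0 u0 p'
      by (simp add: scalar_prod_add_distrib[of _ nx] scalar_prod_mult_mat_vec[of B nx nu])
    have "(\<Sum>i<nu. q 0 i * u 0 $ i) = (\<Sum>i<nu. \<alpha> 0 i * u 0 $ i)
        + (\<Sum>i<nu. u 0 $ i * (b \<bullet> col D i)) + (\<Sum>i<nu. u 0 $ i * (p' \<bullet> col B i))"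
      by (simp add: q_def sum.distrib algebra_simps)
    moreover have "(\<Sum>k<L. \<Sum>i<nu. q (Suc k) i * u (Suc k) $ i) = (\<Sum>k<L. \<Sum>i<nu. q' k i * u (Suc k) $ i)"
      by (simp add: q_def)
    ultimately show ?thesis
      using tail out state p_apply[OF x0] by (simp add: sum.lessThan_Suc_shift del: sum.lessThan_Suc)
  qed
  then show ?case using p p_ann by blast
qed

text \<open>
  The relation \<open>rel\<close> holds along the data at each time. Its \<open>k\<close>-fold shift, expressed through
  the state at the original time, has state coefficient \<open>p A\<^sup>k\<close> and input coefficients that form an
  initial segment of one fixed sequence \<open>e\<close>, listed backwards in time: first the given \<open>q\<close> in reverse, then
  \<open>p B, p A B, \<dots>\<close>. In the combination \<open>\<Sum>\<^sub>k c\<^sub>k (k-th shift)\<close> the state drops out, so its input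
  coefficients \<open>f\<close> vanish. Since \<open>c\<close> is monic, \<open>f\<close> at time \<open>L + K - 1 - s\<close> is \<open>e s\<close> plus a
  combination of earlier terms of \<open>e\<close>, and \<open>e\<close> vanishes up to index \<open>L + K - 1\<close> by induction. The
  recurrence \<open>p c(A) A\<^sup>l B = 0\<close> extends this to all indices.
\<close>

lemma data_relation_trivial:
  fixes q :: "nat \<Rightarrow> nat \<Rightarrow> real" and c :: "nat \<Rightarrow> real"
  assumes sys: "lti_system nx nu ny A B C D" and ctrl: "controllable nx nu A B"
    and traj: "trajectory nx nu A B C D N x u y"
    and pe: "persistently_exciting nu N u (L + K)"
    and p: "p \<in> carrier_vec nx" and monic: "c K = 1"
    and ann: "\<And>z. z \<in> carrier_vec nx \<Longrightarrow> (\<Sum>k\<le>K. c k * (p \<bullet> (A ^\<^sub>m k *\<^sub>v z))) = 0"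
    and rel: "\<And>j. j + L \<le> N \<Longrightarrow> p \<bullet> x j + (\<Sum>t<L. \<Sum>i<nu. q t i * u (j + t) $ i) = 0"
  shows "p = 0\<^sub>v nx \<and> (\<forall>t<L. \<forall>i<nu. q t i = 0)"
proof -
  have A: "A \<in> carrier_mat nx nx" and B: "B \<in> carrier_mat nx nu"
    using sys by (auto simp: lti_system_def)
  define e where "e s i = (if s < L then q (L - Suc s) i else p \<bullet> (A ^\<^sub>m (s - L) *\<^sub>v col B i))" for s i
  have shifted: "p \<bullet> (A ^\<^sub>m k *\<^sub>v x j) + (\<Sum>t<L + k. \<Sum>i<nu. e (L + k - Suc t) i * u (j + t) $ i) = 0"
    if "j + L + k \<le> N" for j k
    using that
  proof (induction k arbitrary: j)
    case (0 j)
    have "(\<Sum>t<L. \<Sum>i<nu. e (L - Suc t) i * u (j + t) $ i) = (\<Sum>t<L. \<Sum>i<nu. q t i * u (j + t) $ i)"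
      by (intro sum.cong refl) (auto simp: e_def)
    then show ?case using rel[of j] 0 A trajectory_state_carrier[OF sys traj, of j] by simp
  next
    case (Suc k j)
    have xj: "x j \<in> carrier_vec nx" and uj: "u j \<in> carrier_vec nu"
      and step: "x (Suc j) = A *\<^sub>v x j + B *\<^sub>v u j"
      using trajectory_state_carrier[OF sys traj, of j] traj Suc.prems by (auto simp: trajectory_def)
    have "p \<bullet> (A ^\<^sub>m k *\<^sub>v x (Suc j)) = p \<bullet> (A ^\<^sub>m Suc k *\<^sub>v x j + A ^\<^sub>m k *\<^sub>v (B *\<^sub>v u j))"
      using A B xj uj
      by (simp add: step pow_mat_vec_Suc mult_add_distrib_mat_vec[of _ nx nx] del: pow_mat.simps(2))
    also have "\<dots> = p \<bullet> (A ^\<^sub>m Suc k *\<^sub>v x j) + p \<bullet> (A ^\<^sub>m k *\<^sub>v (B *\<^sub>v u j))"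
      using p A by (intro scalar_prod_add_distrib[of _ nx] pow_mat_vec_carrier)
    also have "p \<bullet> (A ^\<^sub>m k *\<^sub>v (B *\<^sub>v u j)) = (\<Sum>i<nu. e (L + k) i * u j $ i)"
      by (simp add: scalar_prod_pow_mat_input[OF A B p uj] e_def mult.commute)
    finally have "p \<bullet> (A ^\<^sub>m k *\<^sub>v x (Suc j))
        = p \<bullet> (A ^\<^sub>m Suc k *\<^sub>v x j) + (\<Sum>i<nu. e (L + k) i * u j $ i)" .
    then show ?case
      using Suc.IH[of "Suc j"] Suc.prems by (simp add: sum.lessThan_Suc_shift del: pow_mat.simps(2) sum.lessThan_Suc)
  qed
  define f where "f t i = (\<Sum>k\<le>K. if t < L + k then c k * e (L + k - Suc t) i else 0)" for t i
  have f0: "f t i = 0" if "t < L + K" "i < nu" for t i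
  proof (rule persistently_exciting_annihilator[OF pe _ that])
    fix j assume j: "j + (L + K) \<le> N"
    have "(\<Sum>t<L + K. \<Sum>i<nu. f t i * u (j + t) $ i)
        = (\<Sum>t<L + K. \<Sum>k\<le>K. \<Sum>i<nu. (if t < L + k then c k * e (L + k - Suc t) i else 0) * u (j + t) $ i)"
      unfolding f_def sum_distrib_right by (intro sum.cong refl sum.swap)
    also have "\<dots> = (\<Sum>k\<le>K. \<Sum>t<L + K. \<Sum>i<nu. (if t < L + k then c k * e (L + k - Suc t) i else 0) * u (j + t) $ i)"
      by (rule sum.swap)
    also have "\<dots> = (\<Sum>k\<le>K. c k * (\<Sum>t<L + k. \<Sum>i<nu. e (L + k - Suc t) i * u (j + t) $ i))"
    proof (intro sum.cong refl)
      fix k assume k: "k \<in> {..K}"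
      have "(\<Sum>t<L + K. \<Sum>i<nu. (if t < L + k then c k * e (L + k - Suc t) i else 0) * u (j + t) $ i)
          = (\<Sum>t<L + k. \<Sum>i<nu. (if t < L + k then c k * e (L + k - Suc t) i else 0) * u (j + t) $ i)"
        using k by (intro sum.mono_neutral_right) auto
      also have "\<dots> = c k * (\<Sum>t<L + k. \<Sum>i<nu. e (L + k - Suc t) i * u (j + t) $ i)"
        by (simp add: sum_distrib_left mult.assoc)
      finally show "(\<Sum>t<L + K. \<Sum>i<nu. (if t < L + k then c k * e (L + k - Suc t) i else 0) * u (j + t) $ i)
          = c k * (\<Sum>t<L + k. \<Sum>i<nu. e (L + k - Suc t) i * u (j + t) $ i)" .
    qed
    also have "\<dots> = (\<Sum>k\<le>K. - (c k * (p \<bullet> (A ^\<^sub>m k *\<^sub>v x j))))"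
    proof (intro sum.cong refl)
      fix k assume "k \<in> {..K}"
      then have "(\<Sum>t<L + k. \<Sum>i<nu. e (L + k - Suc t) i * u (j + t) $ i) = - (p \<bullet> (A ^\<^sub>m k *\<^sub>v x j))"
        using shifted[of j k] j by simp
      then show "c k * (\<Sum>t<L + k. \<Sum>i<nu. e (L + k - Suc t) i * u (j + t) $ i)
          = - (c k * (p \<bullet> (A ^\<^sub>m k *\<^sub>v x j)))" by simp
    qed
    also have "\<dots> = 0"
      using ann[OF trajectory_state_carrier[OF sys traj, of j]] j by (simp add: sum_negf)
    finally show "(\<Sum>t<L + K. \<Sum>i<nu. f t i * u (j + t) $ i) = 0" .
  qed
  have e0: "e s i = 0" if "s < L + K" "i < nu" for s i
    using that(1)
  proof (induction s rule: less_induct)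
    case (less s)
    define t where "t = L + K - Suc s"
    have "f t i = (\<Sum>k\<le>K. if k = K then c k * e s i else 0)"
      unfolding f_def
    proof (intro sum.cong refl)
      fix k assume k: "k \<in> {..K}"
      show "(if t < L + k then c k * e (L + k - Suc t) i else 0) = (if k = K then c k * e s i else 0)"
      proof (cases "k = K")
        case True
        then have "t < L + k" "L + k - Suc t = s" using less.prems by (auto simp: t_def)
        then show ?thesis using True by simp
      next
        case False
        have "e (L + k - Suc t) i = 0" if "t < L + k"
        proof (rule less.IH)
          show "L + k - Suc t < s" "L + k - Suc t < L + K"
            using that less.prems k False by (auto simp: t_def)
        qed
        then show ?thesis using False by simp
      qed
    qed
    then show ?case using f0[of t i] less.prems that(2) monic by (simp add: t_def)
  qed
  have "p \<bullet> (A ^\<^sub>m m *\<^sub>v col B i) = 0" if i: "i < nu" for m i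
  proof (induction m rule: less_induct)
    case (less m)
    have b: "col B i \<in> carrier_vec nx" using B i by auto
    show ?case
    proof (cases "m < K")
      case True
      then show ?thesis using e0[of "L + m" i] i by (simp add: e_def)
    next
      case False
      define l where "l = m - K"
      have "0 = (\<Sum>k\<le>K. c k * (p \<bullet> (A ^\<^sub>m k *\<^sub>v (A ^\<^sub>m l *\<^sub>v col B i))))"
        using ann[OF pow_mat_vec_carrier[OF A]] by simp
      also have "\<dots> = (\<Sum>k\<le>K. c k * (p \<bullet> (A ^\<^sub>m (k + l) *\<^sub>v col B i)))"
        by (simp only: pow_mat_vec_add[OF A b])
      also have "\<dots> = (\<Sum>k\<le>K. if k = K then c k * (p \<bullet> (A ^\<^sub>m m *\<^sub>v col B i)) else 0)"
        using False by (intro sum.cong refl) (auto simp: l_def intro!: less.IH)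
      finally show ?thesis using monic by simp
    qed
  qed
  then have "p = 0\<^sub>v nx" by (rule controllable_annihilator[OF A B ctrl p])
  moreover have "q t i = 0" if "t < L" "i < nu" for t i
    using e0[of "L - Suc t" i] that by (simp add: e_def)
  ultimately show ?thesis by blast
qed

section \<open>The behavior as the range of the Hankel matrix\<close>

lemma sum_lessThan_add:
  fixes f :: "nat \<Rightarrow> 'a :: comm_monoid_add"
  shows "(\<Sum>l<m + n. f l) = (\<Sum>l<m. f l) + (\<Sum>l<n. f (m + l))"
  by (induction n) (simp_all add: add.assoc)

lemma scalar_prod_window_external_signal:
  assumes a: "a \<in> carrier_vec (L * (nu + ny))"
    and dims: "\<And>k. k < L \<Longrightarrow> u (j + k) \<in> carrier_vec nu \<and> y (j + k) \<in> carrier_vec ny"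
  shows "a \<bullet> window (nu + ny) L (external_signal u y) j
       = (\<Sum>k<L. (\<Sum>i<nu. a $ (k * (nu + ny) + i) * u (j + k) $ i)
             + (\<Sum>i<ny. a $ (k * (nu + ny) + (nu + i)) * y (j + k) $ i))"
  unfolding scalar_prod_window[OF a]
proof (rule sum.cong[OF refl])
  fix k assume "k \<in> {..<L}"
  then have dim: "dim_vec (u (j + k)) = nu" "dim_vec (y (j + k)) = ny"
    using dims[of k] by auto
  have "(\<Sum>i<nu. a $ (k * (nu + ny) + i) * external_signal u y (j + k) $ i)
      = (\<Sum>i<nu. a $ (k * (nu + ny) + i) * u (j + k) $ i)"
    by (rule sum.cong[OF refl]) (simp add: external_signal_def dim)
  moreover have "(\<Sum>i<ny. a $ (k * (nu + ny) + (nu + i)) * external_signal u y (j + k) $ (nu + i))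
      = (\<Sum>i<ny. a $ (k * (nu + ny) + (nu + i)) * y (j + k) $ i)"
    by (rule sum.cong[OF refl]) (simp add: external_signal_def dim)
  ultimately show "(\<Sum>l<nu + ny. a $ (k * (nu + ny) + l) * external_signal u y (j + k) $ l)
      = (\<Sum>i<nu. a $ (k * (nu + ny) + i) * u (j + k) $ i)
        + (\<Sum>i<ny. a $ (k * (nu + ny) + (nu + i)) * y (j + k) $ i)"
    unfolding sum_lessThan_add by simp
qed

text \<open>
  A functional that annihilates the data windows is, by \<open>observation_functional_state_form\<close>, a
  relation on states and inputs of the data, and such a relation is trivial.
\<close>

lemma external_behavior_subset_range:
  assumes sys: "lti_system nx nu ny A B C D" and ctrl: "controllable nx nu A B"
    and data: "generates nx nu ny A B C D N ud yd"
    and pe: "persistently_exciting nu N ud (L + K)" and monic: "c K = (1 :: real)"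
    and ann: "\<And>i z. i < ny \<Longrightarrow> z \<in> carrier_vec nx \<Longrightarrow>
                (\<Sum>k\<le>K. c k * (row C i \<bullet> (A ^\<^sub>m k *\<^sub>v z))) = 0"
  shows "external_behavior nx nu ny A B C D L
     \<subseteq> (\<lambda>g. hankel (nu + ny) L N (external_signal ud yd) *\<^sub>v g) ` carrier_vec (N + 1 - L)"
proof
  fix v assume "v \<in> external_behavior nx nu ny A B C D L"
  then obtain u y where v: "v = window (nu + ny) L (external_signal u y) 0"
    and gen: "generates nx nu ny A B C D L u y"
    by (auto simp: external_behavior_def)
  obtain x where traj: "trajectory nx nu A B C D L x u y"
    using gen generates_iff_trajectory[OF sys] by blast
  obtain xd where traj_d: "trajectory nx nu A B C D N xd ud yd"
    using data generates_iff_trajectory[OF sys] by blast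
  have "a \<bullet> v = 0" if a: "a \<in> carrier_vec (L * (nu + ny))"
    and orth: "\<And>j. j < N + 1 - L \<Longrightarrow> a \<bullet> col (hankel (nu + ny) L N (external_signal ud yd)) j = 0" for a
  proof -
    obtain p q where p: "p \<in> carrier_vec nx"
      and p_ann: "\<And>z. z \<in> carrier_vec nx \<Longrightarrow> (\<Sum>k\<le>K. c k * (p \<bullet> (A ^\<^sub>m k *\<^sub>v z))) = 0"
      and form: "\<And>x u y. trajectory nx nu A B C D L x u y \<Longrightarrow>
        (\<Sum>k<L. (\<Sum>i<nu. a $ (k * (nu + ny) + i) * u k $ i)
             + (\<Sum>i<ny. a $ (k * (nu + ny) + (nu + i)) * y k $ i))
          = p \<bullet> x 0 + (\<Sum>k<L. \<Sum>i<nu. q k i * u k $ i)"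
      using observation_functional_state_form[OF sys ann, where L = L
          and \<alpha> = "\<lambda>k i. a $ (k * (nu + ny) + i)" and \<beta> = "\<lambda>k i. a $ (k * (nu + ny) + (nu + i))"]
      by blast
    have "p \<bullet> xd j + (\<Sum>t<L. \<Sum>i<nu. q t i * ud (j + t) $ i) = 0" if j: "j + L \<le> N" for j
    proof -
      have "a \<bullet> window (nu + ny) L (external_signal ud yd) j = 0"
        using orth[of j] j by (simp add: col_hankel)
      moreover have "a \<bullet> window (nu + ny) L (external_signal ud yd) j
          = p \<bullet> xd (j + 0) + (\<Sum>t<L. \<Sum>i<nu. q t i * ud (j + t) $ i)"
        unfolding form[OF trajectory_shift[OF sys traj_d j], symmetric]
        by (rule scalar_prod_window_external_signal[OF a]) (use data j in \<open>auto simp: generates_def\<close>)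
      ultimately show ?thesis by simp
    qed
    from data_relation_trivial[OF sys ctrl traj_d pe p, of c, OF monic p_ann this]
    have "p = 0\<^sub>v nx" and q0: "\<And>t i. t < L \<Longrightarrow> i < nu \<Longrightarrow> q t i = 0" by auto
    have "a \<bullet> v = p \<bullet> x 0 + (\<Sum>t<L. \<Sum>i<nu. q t i * u t $ i)"
      unfolding v form[OF traj, symmetric]
      by (subst scalar_prod_window_external_signal[OF a]) (use gen in \<open>auto simp: generates_def\<close>)
    then show ?thesis
      using \<open>p = 0\<^sub>v nx\<close> q0 traj by (simp add: trajectory_def)
  qed
  moreover have "v \<in> carrier_vec (L * (nu + ny))" by (intro carrier_vecI) (simp add: v)
  ultimately show "v \<in> (\<lambda>g. hankel (nu + ny) L N (external_signal ud yd) *\<^sub>v g) ` carrier_vec (N + 1 - L)"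
    using in_range_if_annihilated[OF hankel_carrier] by (auto simp: image_iff)
qed

definition weighted_sum :: "nat \<Rightarrow> nat \<Rightarrow> rvec \<Rightarrow> (nat \<Rightarrow> rvec) \<Rightarrow> rvec" where
  "weighted_sum r m g v = Matrix.vec r (\<lambda>i. \<Sum>j<m. g $ j * v j $ i)"

lemma mult_mat_vec_weighted_sum:
  assumes M: "M \<in> carrier_mat r k" and v: "\<And>j. j < m \<Longrightarrow> v j \<in> carrier_vec k"
  shows "M *\<^sub>v weighted_sum k m g v = weighted_sum r m g (\<lambda>j. M *\<^sub>v v j)"
proof (rule eq_vecI)
  fix i assume "i < dim_vec (weighted_sum r m g (\<lambda>j. M *\<^sub>v v j))"
  then have i: "i < r" by (simp add: weighted_sum_def)
  have "(M *\<^sub>v weighted_sum k m g v) $ i = (\<Sum>l<k. \<Sum>j<m. M $$ (i, l) * (g $ j * v j $ l))"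
    using i M by (simp add: weighted_sum_def scalar_prod_def lessThan_atLeast0 sum_distrib_left)
  also have "\<dots> = (\<Sum>j<m. \<Sum>l<k. M $$ (i, l) * (g $ j * v j $ l))" by (rule sum.swap)
  also have "\<dots> = (\<Sum>j<m. g $ j * (M *\<^sub>v v j) $ i)"
  proof (intro sum.cong refl)
    fix j assume "j \<in> {..<m}"
    then have "v j \<in> carrier_vec k" using v by simp
    then show "(\<Sum>l<k. M $$ (i, l) * (g $ j * v j $ l)) = g $ j * (M *\<^sub>v v j) $ i"
      using i M by (simp add: scalar_prod_def lessThan_atLeast0 sum_distrib_left mult.left_commute)
  qed
  finally show "(M *\<^sub>v weighted_sum k m g v) $ i = weighted_sum r m g (\<lambda>j. M *\<^sub>v v j) $ i"
    using i by (simp add: weighted_sum_def)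
qed (use M in \<open>simp add: weighted_sum_def\<close>)

lemma weighted_sum_add:
  assumes "\<And>j. j < m \<Longrightarrow> v j \<in> carrier_vec r \<and> w j \<in> carrier_vec r"
  shows "weighted_sum r m g v + weighted_sum r m g w = weighted_sum r m g (\<lambda>j. v j + w j)"
proof (rule eq_vecI)
  fix i assume "i < dim_vec (weighted_sum r m g (\<lambda>j. v j + w j))"
  then have i: "i < r" by (simp add: weighted_sum_def)
  have "(\<Sum>j<m. g $ j * (v j + w j) $ i) = (\<Sum>j<m. g $ j * v j $ i + g $ j * w j $ i)"
  proof (rule sum.cong[OF refl])
    fix j assume "j \<in> {..<m}"
    then have "v j \<in> carrier_vec r" "w j \<in> carrier_vec r" using assms by auto
    then show "g $ j * (v j + w j) $ i = g $ j * v j $ i + g $ j * w j $ i"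
      using i by (simp add: distrib_left)
  qed
  then show "(weighted_sum r m g v + weighted_sum r m g w) $ i = weighted_sum r m g (\<lambda>j. v j + w j) $ i"
    using i by (simp add: weighted_sum_def sum.distrib)
qed (simp add: weighted_sum_def)

lemma range_subset_external_behavior:
  assumes sys: "lti_system nx nu ny A B C D"
    and data: "generates nx nu ny A B C D N ud yd"
  shows "(\<lambda>g. hankel (nu + ny) L N (external_signal ud yd) *\<^sub>v g) ` carrier_vec (N + 1 - L)
     \<subseteq> external_behavior nx nu ny A B C D L"
proof
  fix v assume "v \<in> (\<lambda>g. hankel (nu + ny) L N (external_signal ud yd) *\<^sub>v g) ` carrier_vec (N + 1 - L)"
  then obtain g where g: "g \<in> carrier_vec (N + 1 - L)"
    and v: "v = hankel (nu + ny) L N (external_signal ud yd) *\<^sub>v g" by auto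
  have A: "A \<in> carrier_mat nx nx" and B: "B \<in> carrier_mat nx nu"
    and C: "C \<in> carrier_mat ny nx" and D: "D \<in> carrier_mat ny nu"
    using sys by (auto simp: lti_system_def)
  obtain xd where traj: "trajectory nx nu A B C D N xd ud yd"
    using data generates_iff_trajectory[OF sys] by blast
  define m where "m = N + 1 - L"
  define x u y where "x t = weighted_sum nx m g (\<lambda>j. xd (j + t))"
    and "u t = weighted_sum nu m g (\<lambda>j. ud (j + t))"
    and "y t = weighted_sum ny m g (\<lambda>j. yd (j + t))" for t
  have "trajectory nx nu A B C D L x u y"
    unfolding trajectory_def
  proof (intro conjI allI impI)
    show "x 0 \<in> carrier_vec nx" by (simp add: x_def weighted_sum_def)
    fix t assume t: "t < L"
    show "u t \<in> carrier_vec nu" by (simp add: u_def weighted_sum_def)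
    have at: "xd (j + t) \<in> carrier_vec nx" "ud (j + t) \<in> carrier_vec nu"
      "xd (Suc (j + t)) = A *\<^sub>v xd (j + t) + B *\<^sub>v ud (j + t)"
      "yd (j + t) = C *\<^sub>v xd (j + t) + D *\<^sub>v ud (j + t)" if "j < m" for j
      using that t traj trajectory_state_carrier[OF sys traj, of "j + t"]
      by (auto simp: m_def trajectory_def)
    have "A *\<^sub>v x t + B *\<^sub>v u t = weighted_sum nx m g (\<lambda>j. A *\<^sub>v xd (j + t) + B *\<^sub>v ud (j + t))"
      unfolding x_def u_def using A B at
      by (simp add: mult_mat_vec_weighted_sum[OF A] mult_mat_vec_weighted_sum[OF B] weighted_sum_add)
    also have "\<dots> = x (Suc t)"
      unfolding x_def weighted_sum_def by (intro arg_cong2[where f = Matrix.vec] ext sum.cong refl) (simp add: at)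
    finally show "x (Suc t) = A *\<^sub>v x t + B *\<^sub>v u t" ..
    have "C *\<^sub>v x t + D *\<^sub>v u t = weighted_sum ny m g (\<lambda>j. C *\<^sub>v xd (j + t) + D *\<^sub>v ud (j + t))"
      unfolding x_def u_def using C D at
      by (simp add: mult_mat_vec_weighted_sum[OF C] mult_mat_vec_weighted_sum[OF D] weighted_sum_add)
    also have "\<dots> = y t"
      unfolding y_def weighted_sum_def by (intro arg_cong2[where f = Matrix.vec] ext sum.cong refl) (simp add: at)
    finally show "y t = C *\<^sub>v x t + D *\<^sub>v u t" ..
  qed
  then have "generates nx nu ny A B C D L u y" using generates_iff_trajectory[OF sys] by blast
  moreover have "v = window (nu + ny) L (external_signal u y) 0"
  proof (rule eq_vecI)
    fix i assume "i < dim_vec (window (nu + ny) L (external_signal u y) 0)"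
    then have i: "i < L * (nu + ny)" by simp
    define t l where "t = i div (nu + ny)" and "l = i mod (nu + ny)"
    have "0 < nu + ny" using i by (cases "nu + ny = 0") auto
    then have l: "l < nu + ny" and t: "t < L"
      using i by (auto simp: l_def t_def less_mult_imp_div_less)
    have "v $ i = (\<Sum>j<m. g $ j * external_signal ud yd (j + t) $ l)"
      using i g by (simp add: v hankel_def m_def scalar_prod_def lessThan_atLeast0 mat_of_cols_def
          window_def t_def l_def mult.commute)
    also have "\<dots> = external_signal u y t $ l"
    proof -
      have "external_signal ud yd (j + t) $ l = (if l < nu then ud (j + t) $ l else yd (j + t) $ (l - nu))"
        if "j < m" for j
      proof -
        have "ud (j + t) \<in> carrier_vec nu" "yd (j + t) \<in> carrier_vec ny"
          using data that t by (auto simp: generates_def m_def)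
        then show ?thesis using l by (simp add: external_signal_def)
      qed
      then show ?thesis using l by (simp add: external_signal_def u_def y_def weighted_sum_def)
    qed
    also have "\<dots> = window (nu + ny) L (external_signal u y) 0 $ i"
      using i by (simp add: window_def t_def l_def)
    finally show "v $ i = window (nu + ny) L (external_signal u y) 0 $ i" .
  qed (simp add: v hankel_def)
  ultimately show "v \<in> external_behavior nx nu ny A B C D L"
    by (auto simp: external_behavior_def)
qed

theorem theorem4p5:
  fixes nx nu ny n L N :: nat
    and A B C D :: "real Matrix.mat"
    and ud yd :: "nat \<Rightarrow> real Matrix.vec"
  assumes system: "lti_system nx nu ny A B C D"
    and ctrl: "controllable nx nu A B"
    and degree: "n = mcmillan_degree nu ny (transfer_function A B C D)"
    and data: "generates nx nu ny A B C D N ud yd"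
  shows "(persistently_exciting nu N ud (L + n) \<longrightarrow>
            behavioral_measures nx nu ny A B C D L =
              {mat_push (hankel (nu + ny) L N (external_signal ud yd)) \<nu> | \<nu>.
                 \<nu> \<in> vec_probs (N + 1 - L)})
       \<and> (\<forall>nbar \<ge> n. persistently_exciting nu N ud (L + nbar) \<longrightarrow>
            behavioral_measures nx nu ny A B C D L =
              {mat_push (hankel (nu + ny) L N (external_signal ud yd)) \<nu> | \<nu>.
                 \<nu> \<in> vec_probs (N + 1 - L)})
       \<and> n \<le> nx"
proof -
  let ?H = "hankel (nu + ny) L N (external_signal ud yd)"
  let ?realizes = "\<lambda>m. \<exists>A' B' C' D'. lti_system m nu ny A' B' C' D' \<and>
    transfer_function A' B' C' D' = transfer_function A B C D"
  have "?realizes nx" using system by blast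
  then have "?realizes n" and "n \<le> nx"
    unfolding degree mcmillan_degree_def by (rule LeastI[of ?realizes], rule Least_le[of ?realizes])
  then obtain A' B' C' D' where sys': "lti_system n nu ny A' B' C' D'"
    and same: "transfer_function A B C D = transfer_function A' B' C' D'" by metis
  have chi: "degree (char_poly A') = n" "coeff (char_poly A') n = 1"
    using sys' degree_monic_char_poly[of A' n] by (auto simp: lti_system_def)
  have "behavioral_measures nx nu ny A B C D L = {mat_push ?H \<nu> | \<nu>. \<nu> \<in> vec_probs (N + 1 - L)}"
    if nbar: "n \<le> nbar" and pe: "persistently_exciting nu N ud (L + nbar)" for nbar
  proof -
    \<comment> \<open>Raise the degree of the annihilating polynomial to match the order of excitation.\<close>
    define c where "c = monom 1 (nbar - n) * char_poly A'"
    have "char_poly A' \<noteq> 0" using chi by auto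
    then have deg: "degree c = nbar"
      using nbar chi by (simp add: c_def degree_mult_eq degree_monom_eq)
    have monic: "coeff c nbar = 1"
      using nbar chi by (simp add: c_def coeff_monom_mult)
    have "(\<Sum>k\<le>nbar. coeff c k * (row C i \<bullet> (A ^\<^sub>m k *\<^sub>v z))) = 0"
      if "i < ny" "z \<in> carrier_vec nx" for i z
      using transfer_function_annihilating_poly[OF system sys' ctrl same _ that, of c]
      unfolding deg by (simp add: c_def)
    then have "external_behavior nx nu ny A B C D L = (\<lambda>g. ?H *\<^sub>v g) ` carrier_vec (N + 1 - L)"
      using external_behavior_subset_range[OF system ctrl data pe, of "coeff c"] monic
        range_subset_external_behavior[OF system data] by blast
    then show ?thesis
      unfolding behavioral_measures_def using vec_probs_on_range[OF hankel_carrier] by simp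
  qed
  then show ?thesis using \<open>n \<le> nx\<close> by blast
qed

end
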